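(* Let $\mathcal{D}=\langle\mathcal{A},\mathcal{B}\rangle$ be a triangulated category with a semiorthogonal decomposition, and let $\sigma_{\mathcal{A}}=(\mathcal{A}_0,Z_{\mathcal{A}})$ and $\sigma_{\mathcal{B}}=(\mathcal{B}_0,Z_{\mathcal{B}})$ be stability conditions on the components, with slicings $\mathcal{P}_{\mathcal{A}},\mathcal{P}_{\mathcal{B}}$ (so $\mathcal{A}_0=\mathcal{P}_{\mathcal{A}}(0,1]$, $\mathcal{B}_0=\mathcal{P}_{\mathcal{B}}(0,1]$), such that (CP1) $\mathrm{Hom}^{\le0}_{\mathcal{D}}(\mathcal{P}_{\mathcal{A}}(0,1],\mathcal{P}_{\mathcal{B}}(0,1])=0$. Then the condition (CP2) $\mathrm{Hom}^{\le0}_{\mathcal{D}}(\mathcal{P}_{\mathcal{A}}(\alpha,\alpha+1],\mathcal{P}_{\mathcal{B}}(\alpha,\alpha+1])=0$ for some $\alpha\in(0,1)$ is equivalent to the condition (CP3) there exists $\alpha\in(0,1)$ such that for every nonzero $\sigma_{\mathcal{A}}$-semistable object $A\in\mathcal{A}_0$ and every nonzero $\sigma_{\mathcal{B}}$-semistable object $B\in\mathcal{B}_0$, $$\phi_{\mathcal{B}}(B)\le\alpha<\phi_{\mathcal{A}}(A)\quad\Longrightarrow\quad M_0(A,B)=\mathrm{Ext}^1_{\mathrm{gl}(\mathcal{A}_0,\mathcal{B}_0)}(A,B)=0 .$$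
   Context: Semiorthogonal decomposition $\mathcal{D}=\langle\mathcal{A},\mathcal{B}\rangle$: full triangulated subcategories with $\mathrm{Hom}_{\mathcal{D}}(\mathcal{B},\mathcal{A})=0$ and every $E\in\mathcal{D}$ in a triangle $B\to E\to A\to B[1]$, $A\in\mathcal{A}$, $B\in\mathcal{B}$. $\mathrm{Hom}^{\le0}_{\mathcal{D}}(\mathcal{X},\mathcal{Y})=0$ means $\mathrm{Hom}_{\mathcal{D}}(X,Y[i])=0$ for all $X\in\mathcal{X}$, $Y\in\mathcal{Y}$, $i\le0$. A stability condition on a triangulated category is a locally finite Bridgeland stability condition $(Z,\mathcal{P})$ satisfying the support property (there are a finite-rank free abelian group $\Lambda$ through which $Z\colon K_0\xrightarrow{u}\Lambda\to\mathbb{C}$ factors, a norm on $\Lambda\otimes\mathbb{R}$ and $C>0$ with $\|u([E])\|\le C|Z(E)|$ for all semistable $E$). It is equivalently written $(\mathcal{P}(0,1],Z)$ (heart and central charge). $\mathcal{P}(I)$ is the extension closure of the $\mathcal{P}(\phi)$, $\phi\in I$; $\phi_{\mathcal{A}},\phi_{\mathcal{B}}$ denote the phases of semistable objects with respect to $\sigma_{\mathcal{A}},\sigma_{\mathcal{B}}$. Under (CP1), $\mathrm{gl}(\mathcal{A}_0,\mathcal{B}_0)$, the extension closure of $\mathcal{A}_0$ and $\mathcal{B}_0$ in $\mathcal{D}$, is the heart of a $t$-structure on $\mathcal{D}$; thus $\mathrm{Ext}^1_{\mathrm{gl}(\mathcal{A}_0,\mathcal{B}_0)}(A,B)\cong\mathrm{Hom}_{\mathcal{D}}(A,B[1])$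 for $A\in\mathcal{A}_0,B\in\mathcal{B}_0$. *)

theory Defs
  imports Complex_Main "HOL-Algebra.Free_Abelian_Groups"
begin

section \<open>Categories and additive categories\<close>

text \<open>Every arrow carries its domain and codomain. \<open>g \<star>\<^bsub>C\<^esub> f\<close> is ``\<open>g\<close> after \<open>f\<close>'' and is
  meaningful only if \<open>Cod C f = Dom C g\<close>. The fields \<open>AddM\<close> and \<open>ZeroM\<close> hold the group structures on
  the Hom-sets; \<open>ZeroM C X Y\<close> is the zero arrow from \<open>X\<close> to \<open>Y\<close>.\<close>

record ('o, 'm) cat =
  Ob :: "'o set"
  Arr :: "'m set"
  Dom :: "'m \<Rightarrow> 'o"
  Cod :: "'m \<Rightarrow> 'o"
  Ident :: "'o \<Rightarrow> 'm"
  Comp :: "'m \<Rightarrow> 'm \<Rightarrow> 'm"  (infixr \<open>\<star>\<index>\<close> 70)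
  AddM :: "'m \<Rightarrow> 'm \<Rightarrow> 'm"
  ZeroM :: "'o \<Rightarrow> 'o \<Rightarrow> 'm"

definition Hom :: "('o, 'm, 'x) cat_scheme \<Rightarrow> 'o \<Rightarrow> 'o \<Rightarrow> 'm set" where
  "Hom C X Y = {f \<in> Arr C. Dom C f = X \<and> Cod C f = Y}"

definition Hom_group :: "('o, 'm, 'x) cat_scheme \<Rightarrow> 'o \<Rightarrow> 'o \<Rightarrow> 'm monoid" where
  "Hom_group C X Y = \<lparr>carrier = Hom C X Y, monoid.mult = AddM C, one = ZeroM C X Y\<rparr>"

definition NegM :: "('o, 'm, 'x) cat_scheme \<Rightarrow> 'm \<Rightarrow> 'm" where
  "NegM C f = inv\<^bsub>Hom_group C (Dom C f) (Cod C f)\<^esub> f"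

definition iso_arrow :: "('o, 'm, 'x) cat_scheme \<Rightarrow> 'm \<Rightarrow> bool" where
  "iso_arrow C f \<longleftrightarrow> f \<in> Arr C \<and>
     (\<exists>g \<in> Hom C (Cod C f) (Dom C f).
        g \<star>\<^bsub>C\<^esub> f = Ident C (Dom C f) \<and> f \<star>\<^bsub>C\<^esub> g = Ident C (Cod C f))"

definition zero_obj :: "('o, 'm, 'x) cat_scheme \<Rightarrow> 'o \<Rightarrow> bool" where
  "zero_obj C X \<longleftrightarrow> X \<in> Ob C \<and>
     (\<forall>Y \<in> Ob C. (\<exists>!f. f \<in> Hom C X Y) \<and> (\<exists>!f. f \<in> Hom C Y X))"

definition biproduct ::
  "('o, 'm, 'x) cat_scheme \<Rightarrow> 'o \<Rightarrow> 'o \<Rightarrow> 'o \<Rightarrow> 'm \<Rightarrow> 'm \<Rightarrow> 'm \<Rightarrow> 'm \<Rightarrow> bool" where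
  "biproduct C X Y S i\<^sub>1 i\<^sub>2 p\<^sub>1 p\<^sub>2 \<longleftrightarrow> S \<in> Ob C \<and>
     i\<^sub>1 \<in> Hom C X S \<and> i\<^sub>2 \<in> Hom C Y S \<and> p\<^sub>1 \<in> Hom C S X \<and> p\<^sub>2 \<in> Hom C S Y \<and>
     p\<^sub>1 \<star>\<^bsub>C\<^esub> i\<^sub>1 = Ident C X \<and> p\<^sub>2 \<star>\<^bsub>C\<^esub> i\<^sub>2 = Ident C Y \<and>
     p\<^sub>2 \<star>\<^bsub>C\<^esub> i\<^sub>1 = ZeroM C X Y \<and> p\<^sub>1 \<star>\<^bsub>C\<^esub> i\<^sub>2 = ZeroM C Y X \<and>
     AddM C (i\<^sub>1 \<star>\<^bsub>C\<^esub> p\<^sub>1) (i\<^sub>2 \<star>\<^bsub>C\<^esub> p\<^sub>2) = Ident C S"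

locale category =
  fixes C :: "('o, 'm, 'x) cat_scheme" (structure)
  assumes Dom_in_Ob: "f \<in> Arr C \<Longrightarrow> Dom C f \<in> Ob C"
    and Cod_in_Ob: "f \<in> Arr C \<Longrightarrow> Cod C f \<in> Ob C"
    and Ident_in_Hom: "X \<in> Ob C \<Longrightarrow> Ident C X \<in> Hom C X X"
    and Comp_in_Hom: "f \<in> Hom C X Y \<Longrightarrow> g \<in> Hom C Y Z \<Longrightarrow> g \<star> f \<in> Hom C X Z"
    and Comp_Ident_left: "f \<in> Hom C X Y \<Longrightarrow> Ident C Y \<star> f = f"
    and Comp_Ident_right: "f \<in> Hom C X Y \<Longrightarrow> f \<star> Ident C X = f"
    and Comp_assoc: "f \<in> Hom C W X \<Longrightarrow> g \<in> Hom C X Y \<Longrightarrow> h \<in> Hom C Y Z \<Longrightarrow>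
      (h \<star> g) \<star> f = h \<star> (g \<star> f)"

locale preadditive_category = category +
  assumes Hom_comm_group: "X \<in> Ob C \<Longrightarrow> Y \<in> Ob C \<Longrightarrow> comm_group (Hom_group C X Y)"
    and Comp_AddM_left: "f \<in> Hom C X Y \<Longrightarrow> g \<in> Hom C Y Z \<Longrightarrow> g' \<in> Hom C Y Z \<Longrightarrow>
      AddM C g g' \<star> f = AddM C (g \<star> f) (g' \<star> f)"
    and Comp_AddM_right: "f \<in> Hom C X Y \<Longrightarrow> f' \<in> Hom C X Y \<Longrightarrow> g \<in> Hom C Y Z \<Longrightarrow>
      g \<star> AddM C f f' = AddM C (g \<star> f) (g \<star> f')"

locale additive_category = preadditive_category +
  assumes zero_obj_exists: "\<exists>X. zero_obj C X"
    and biproduct_exists: "X \<in> Ob C \<Longrightarrow> Y \<in> Ob C \<Longrightarrow> \<exists>S i\<^sub>1 i\<^sub>2 p\<^sub>1 p\<^sub>2. biproduct C X Y S i\<^sub>1 i\<^sub>2 p\<^sub>1 p\<^sub>2"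

text \<open>Full subcategories are given by sets of objects; they are not required to be closed under
  isomorphism.\<close>

definition full_sub :: "('o, 'm, 'x) cat_scheme \<Rightarrow> 'o set \<Rightarrow> ('o, 'm, 'x) cat_scheme" where
  "full_sub C S = C\<lparr>Ob := S, Arr := {f \<in> Arr C. Dom C f \<in> S \<and> Cod C f \<in> S}\<rparr>"

definition full_additive_subcategory :: "('o, 'm, 'x) cat_scheme \<Rightarrow> 'o set \<Rightarrow> bool" where
  "full_additive_subcategory C S \<longleftrightarrow> S \<subseteq> Ob C \<and> additive_category (full_sub C S)"


section \<open>Short exact sequences, first extension groups, finite length\<close>

definition is_kernel :: "('o, 'm, 'x) cat_scheme \<Rightarrow> 'm \<Rightarrow> 'm \<Rightarrow> bool" where
  "is_kernel C i j \<longleftrightarrow> i \<in> Arr C \<and> j \<in> Arr C \<and> Cod C i = Dom C j \<and>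
     j \<star>\<^bsub>C\<^esub> i = ZeroM C (Dom C i) (Cod C j) \<and>
     (\<forall>W \<in> Ob C. \<forall>w \<in> Hom C W (Dom C j). j \<star>\<^bsub>C\<^esub> w = ZeroM C W (Cod C j) \<longrightarrow>
        (\<exists>!v. v \<in> Hom C W (Dom C i) \<and> i \<star>\<^bsub>C\<^esub> v = w))"

definition is_cokernel :: "('o, 'm, 'x) cat_scheme \<Rightarrow> 'm \<Rightarrow> 'm \<Rightarrow> bool" where
  "is_cokernel C j i \<longleftrightarrow> i \<in> Arr C \<and> j \<in> Arr C \<and> Cod C i = Dom C j \<and>
     j \<star>\<^bsub>C\<^esub> i = ZeroM C (Dom C i) (Cod C j) \<and>
     (\<forall>W \<in> Ob C. \<forall>w \<in> Hom C (Cod C i) W. w \<star>\<^bsub>C\<^esub> i = ZeroM C (Dom C i) W \<longrightarrow>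
        (\<exists>!v. v \<in> Hom C (Cod C j) W \<and> v \<star>\<^bsub>C\<^esub> j = w))"

definition short_exact :: "('o, 'm, 'x) cat_scheme \<Rightarrow> 'm \<Rightarrow> 'm \<Rightarrow> bool" where
  "short_exact C i j \<longleftrightarrow> is_kernel C i j \<and> is_cokernel C j i"

definition extensions :: "('o, 'm, 'x) cat_scheme \<Rightarrow> 'o \<Rightarrow> 'o \<Rightarrow> ('m \<times> 'm) set" where
  "extensions C A B = {(i, j). short_exact C i j \<and> Dom C i = B \<and> Cod C j = A}"

definition extension_equiv ::
  "('o, 'm, 'x) cat_scheme \<Rightarrow> 'o \<Rightarrow> 'o \<Rightarrow> (('m \<times> 'm) \<times> ('m \<times> 'm)) set" where
  "extension_equiv C A B = {((i, j), (i', j')).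
     (i, j) \<in> extensions C A B \<and> (i', j') \<in> extensions C A B \<and>
     (\<exists>e \<in> Hom C (Cod C i) (Cod C i'). iso_arrow C e \<and> e \<star>\<^bsub>C\<^esub> i = i' \<and> j' \<star>\<^bsub>C\<^esub> e = j)}"

text \<open>The Yoneda group \<open>Ext\<^sup>1(A, B)\<close> of an abelian category, as a set: equivalence classes of short
  exact sequences \<open>0 \<rightarrow> B \<rightarrow> E \<rightarrow> A \<rightarrow> 0\<close>. Its zero element (for the Baer sum) is the class of split
  sequences, so that \<open>Ext\<^sup>1(A, B) = 0\<close> reads \<open>Ext1 C A B = {Ext1_zero C A B}\<close>.\<close>

definition Ext1 :: "('o, 'm, 'x) cat_scheme \<Rightarrow> 'o \<Rightarrow> 'o \<Rightarrow> ('m \<times> 'm) set set" where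
  "Ext1 C A B = extensions C A B // extension_equiv C A B"

definition Ext1_zero :: "('o, 'm, 'x) cat_scheme \<Rightarrow> 'o \<Rightarrow> 'o \<Rightarrow> ('m \<times> 'm) set" where
  "Ext1_zero C A B =
     {(i, j) \<in> extensions C A B. \<exists>s \<in> Hom C A (Dom C j). j \<star>\<^bsub>C\<^esub> s = Ident C A}"

text \<open>Strict monomorphisms, as in quasi-abelian categories: the arrows \<open>i\<close> occurring in a strict short
  exact sequence, that is, \<open>i\<close> is a kernel of \<open>j\<close> and \<open>j\<close> a cokernel of \<open>i\<close>. Strict epimorphisms, dually,
  give the same notion of finite length.\<close>

definition strict_mono_arrow :: "('o, 'm, 'x) cat_scheme \<Rightarrow> 'm \<Rightarrow> bool" where
  "strict_mono_arrow C i \<longleftrightarrow> (\<exists>j. short_exact C i j)"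

definition subobject_le :: "('o, 'm, 'x) cat_scheme \<Rightarrow> 'm \<Rightarrow> 'm \<Rightarrow> bool" where
  "subobject_le C s t \<longleftrightarrow> (\<exists>k \<in> Hom C (Dom C s) (Dom C t). t \<star>\<^bsub>C\<^esub> k = s)"

definition finite_length :: "('o, 'm, 'x) cat_scheme \<Rightarrow> bool" where
  "finite_length C \<longleftrightarrow> (\<forall>E \<in> Ob C. \<forall>s :: nat \<Rightarrow> 'm.
     (\<forall>n. strict_mono_arrow C (s n) \<and> Cod C (s n) = E) \<longrightarrow>
     ((\<forall>n. subobject_le C (s n) (s (Suc n))) \<longrightarrow> (\<exists>N. \<forall>n\<ge>N. subobject_le C (s n) (s N))) \<and>
     ((\<forall>n. subobject_le C (s (Suc n)) (s n)) \<longrightarrow> (\<exists>N. \<forall>n\<ge>N. subobject_le C (s N) (s n))))"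


section \<open>Triangulated categories\<close>

text \<open>The translation is a strict action of the integers: \<open>ShO T n X\<close> is \<open>X[n]\<close> and \<open>ShA T n f\<close> is \<open>f[n]\<close>.
  A distinguished triangle \<open>X \<rightarrow> Y \<rightarrow> Z \<rightarrow> X[1]\<close> is recorded by its three arrows.\<close>

record ('o, 'm) tricat = "('o, 'm) cat" +
  ShO :: "int \<Rightarrow> 'o \<Rightarrow> 'o"
  ShA :: "int \<Rightarrow> 'm \<Rightarrow> 'm"
  Tri :: "('m \<times> 'm \<times> 'm) set"

locale triangulated_category = additive_category T
  for T :: "('o, 'm, 'x) tricat_scheme" (structure) +
  assumes ShO_in_Ob: "X \<in> Ob T \<Longrightarrow> ShO T n X \<in> Ob T"
    and ShA_in_Hom: "f \<in> Hom T X Y \<Longrightarrow> ShA T n f \<in> Hom T (ShO T n X) (ShO T n Y)"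
    and ShA_Ident: "X \<in> Ob T \<Longrightarrow> ShA T n (Ident T X) = Ident T (ShO T n X)"
    and ShA_Comp: "f \<in> Hom T X Y \<Longrightarrow> g \<in> Hom T Y Z \<Longrightarrow> ShA T n (g \<star> f) = ShA T n g \<star> ShA T n f"
    and ShA_AddM: "f \<in> Hom T X Y \<Longrightarrow> g \<in> Hom T X Y \<Longrightarrow>
      ShA T n (AddM T f g) = AddM T (ShA T n f) (ShA T n g)"
    and ShO_0: "X \<in> Ob T \<Longrightarrow> ShO T 0 X = X"
    and ShA_0: "f \<in> Arr T \<Longrightarrow> ShA T 0 f = f"
    and ShO_add: "X \<in> Ob T \<Longrightarrow> ShO T (m + n) X = ShO T m (ShO T n X)"
    and ShA_add: "f \<in> Arr T \<Longrightarrow> ShA T (m + n) f = ShA T m (ShA T n f)"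
    and Tri_wf: "(f, g, h) \<in> Tri T \<Longrightarrow>
      \<exists>X Y Z. f \<in> Hom T X Y \<and> g \<in> Hom T Y Z \<and> h \<in> Hom T Z (ShO T 1 X)"
    and TR1_iso: "(f, g, h) \<in> Tri T \<Longrightarrow>
      f \<in> Hom T X Y \<Longrightarrow> g \<in> Hom T Y Z \<Longrightarrow> h \<in> Hom T Z (ShO T 1 X) \<Longrightarrow>
      f' \<in> Hom T X' Y' \<Longrightarrow> g' \<in> Hom T Y' Z' \<Longrightarrow> h' \<in> Hom T Z' (ShO T 1 X') \<Longrightarrow>
      a \<in> Hom T X X' \<Longrightarrow> b \<in> Hom T Y Y' \<Longrightarrow> c \<in> Hom T Z Z' \<Longrightarrow>
      iso_arrow T a \<Longrightarrow> iso_arrow T b \<Longrightarrow> iso_arrow T c \<Longrightarrow>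
      b \<star> f = f' \<star> a \<Longrightarrow> c \<star> g = g' \<star> b \<Longrightarrow> ShA T 1 a \<star> h = h' \<star> c \<Longrightarrow>
      (f', g', h') \<in> Tri T"
    and TR1_Ident: "X \<in> Ob T \<Longrightarrow> zero_obj T N \<Longrightarrow>
      (Ident T X, ZeroM T X N, ZeroM T N (ShO T 1 X)) \<in> Tri T"
    and TR1_cone: "f \<in> Arr T \<Longrightarrow> \<exists>g h. (f, g, h) \<in> Tri T"
    and TR2: "f \<in> Hom T X Y \<Longrightarrow> g \<in> Hom T Y Z \<Longrightarrow> h \<in> Hom T Z (ShO T 1 X) \<Longrightarrow>
      (f, g, h) \<in> Tri T \<longleftrightarrow> (g, h, NegM T (ShA T 1 f)) \<in> Tri T"
    and TR3: "(f, g, h) \<in> Tri T \<Longrightarrow> (f', g', h') \<in> Tri T \<Longrightarrow>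
      a \<in> Hom T (Dom T f) (Dom T f') \<Longrightarrow> b \<in> Hom T (Cod T f) (Cod T f') \<Longrightarrow>
      b \<star> f = f' \<star> a \<Longrightarrow>
      \<exists>c \<in> Hom T (Cod T g) (Cod T g'). c \<star> g = g' \<star> b \<and> ShA T 1 a \<star> h = h' \<star> c"
    and TR4: "f \<in> Hom T X Y \<Longrightarrow> g \<in> Hom T Y Z \<Longrightarrow>
      (f, p\<^sub>1, d\<^sub>1) \<in> Tri T \<Longrightarrow> (g \<star> f, p\<^sub>2, d\<^sub>2) \<in> Tri T \<Longrightarrow> (g, p\<^sub>3, d\<^sub>3) \<in> Tri T \<Longrightarrow>
      \<exists>a \<in> Hom T (Cod T p\<^sub>1) (Cod T p\<^sub>2). \<exists>b \<in> Hom T (Cod T p\<^sub>2) (Cod T p\<^sub>3).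
        (a, b, ShA T 1 p\<^sub>1 \<star> d\<^sub>3) \<in> Tri T \<and>
        a \<star> p\<^sub>1 = p\<^sub>2 \<star> g \<and> d\<^sub>2 \<star> a = d\<^sub>1 \<and>
        b \<star> p\<^sub>2 = p\<^sub>3 \<and> d\<^sub>3 \<star> b = ShA T 1 f \<star> d\<^sub>2"

definition dist_triangle :: "('o, 'm, 'x) tricat_scheme \<Rightarrow> 'o \<Rightarrow> 'o \<Rightarrow> 'o \<Rightarrow> bool" where
  "dist_triangle T X Y Z \<longleftrightarrow>
     (\<exists>f g h. (f, g, h) \<in> Tri T \<and> f \<in> Hom T X Y \<and> g \<in> Hom T Y Z \<and> h \<in> Hom T Z (ShO T 1 X))"

definition tri_sub :: "('o, 'm, 'x) tricat_scheme \<Rightarrow> 'o set \<Rightarrow> ('o, 'm, 'x) tricat_scheme" where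
  "tri_sub T S = (full_sub T S)
     \<lparr>Tri := {(f, g, h) \<in> Tri T. Dom T f \<in> S \<and> Cod T f \<in> S \<and> Cod T g \<in> S}\<rparr>"

definition full_triangulated_subcategory :: "('o, 'm, 'x) tricat_scheme \<Rightarrow> 'o set \<Rightarrow> bool" where
  "full_triangulated_subcategory T S \<longleftrightarrow> S \<subseteq> Ob T \<and> triangulated_category (tri_sub T S)"

inductive_set ext_closure :: "('o, 'm, 'x) tricat_scheme \<Rightarrow> 'o set \<Rightarrow> 'o set"
  for T :: "('o, 'm, 'x) tricat_scheme" and S :: "'o set" where
  incl: "X \<in> S \<Longrightarrow> X \<in> ext_closure T S"
| ext: "X \<in> ext_closure T S \<Longrightarrow> Z \<in> ext_closure T S \<Longrightarrow> dist_triangle T X Y Z \<Longrightarrow>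
    Y \<in> ext_closure T S"

definition Hom_vanish :: "('o, 'm, 'x) tricat_scheme \<Rightarrow> 'o set \<Rightarrow> 'o set \<Rightarrow> bool" where
  "Hom_vanish T \<X> \<Y> \<longleftrightarrow> (\<forall>X \<in> \<X>. \<forall>Y \<in> \<Y>. Hom T X Y = {ZeroM T X Y})"

definition Hom_le0_vanish :: "('o, 'm, 'x) tricat_scheme \<Rightarrow> 'o set \<Rightarrow> 'o set \<Rightarrow> bool" where
  "Hom_le0_vanish T \<X> \<Y> \<longleftrightarrow>
     (\<forall>X \<in> \<X>. \<forall>Y \<in> \<Y>. \<forall>i \<le> 0. Hom T X (ShO T i Y) = {ZeroM T X (ShO T i Y)})"

definition semiorthogonal_decomposition ::
  "('o, 'm, 'x) tricat_scheme \<Rightarrow> 'o set \<Rightarrow> 'o set \<Rightarrow> bool" where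
  "semiorthogonal_decomposition T \<A> \<B> \<longleftrightarrow>
     full_triangulated_subcategory T \<A> \<and> full_triangulated_subcategory T \<B> \<and>
     Hom_vanish T \<B> \<A> \<and>
     (\<forall>E \<in> Ob T. \<exists>A \<in> \<A>. \<exists>B \<in> \<B>. dist_triangle T B E A)"


section \<open>Stability conditions\<close>

definition K0_relations :: "('o, 'm, 'x) tricat_scheme \<Rightarrow> ('o \<Rightarrow>\<^sub>0 int) set" where
  "K0_relations T = generate (free_Abelian_group (Ob T))
     {frag_of Y - frag_of X - frag_of Z | X Y Z. dist_triangle T X Y Z}"

definition K0 :: "('o, 'm, 'x) tricat_scheme \<Rightarrow> ('o \<Rightarrow>\<^sub>0 int) set monoid" where
  "K0 T = free_Abelian_group (Ob T) Mod K0_relations T"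

definition K0_class :: "('o, 'm, 'x) tricat_scheme \<Rightarrow> 'o \<Rightarrow> ('o \<Rightarrow>\<^sub>0 int) set" where
  "K0_class T E = K0_relations T #>\<^bsub>free_Abelian_group (Ob T)\<^esub> frag_of E"

definition complex_group :: "complex monoid" where
  "complex_group = \<lparr>carrier = UNIV, monoid.mult = (+), one = 0\<rparr>"

definition slicing :: "('o, 'm, 'x) tricat_scheme \<Rightarrow> (real \<Rightarrow> 'o set) \<Rightarrow> bool" where
  "slicing T P \<longleftrightarrow>
     (\<forall>\<phi>. full_additive_subcategory T (P \<phi>)) \<and>
     (\<forall>\<phi>. P (\<phi> + 1) = ShO T 1 ` P \<phi>) \<and>
     (\<forall>\<phi>\<^sub>1 \<phi>\<^sub>2. \<phi>\<^sub>1 > \<phi>\<^sub>2 \<longrightarrow> Hom_vanish T (P \<phi>\<^sub>1) (P \<phi>\<^sub>2)) \<and>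
     (\<forall>E \<in> Ob T. \<not> zero_obj T E \<longrightarrow>
       (\<exists>(n :: nat) (\<phi> :: nat \<Rightarrow> real) (F :: nat \<Rightarrow> 'o) (A :: nat \<Rightarrow> 'o).
          (\<forall>j k. j < k \<and> k < n \<longrightarrow> \<phi> j > \<phi> k) \<and> zero_obj T (F 0) \<and> F n = E \<and>
          (\<forall>j < n. A j \<in> P (\<phi> j) \<and> dist_triangle T (F j) (F (Suc j)) (A j))))"

definition slice :: "('o, 'm, 'x) tricat_scheme \<Rightarrow> (real \<Rightarrow> 'o set) \<Rightarrow> real set \<Rightarrow> 'o set" where
  "slice T P I = ext_closure T (\<Union>\<phi>\<in>I. P \<phi>)"

text \<open>The bound \<open>\<eta> < 1/2\<close> makes the interval shorter than 1, so that the full subcategory in question is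
  quasi-abelian.\<close>

definition locally_finite :: "('o, 'm, 'x) tricat_scheme \<Rightarrow> (real \<Rightarrow> 'o set) \<Rightarrow> bool" where
  "locally_finite T P \<longleftrightarrow>
     (\<exists>\<eta>. 0 < \<eta> \<and> \<eta> < 1 / 2 \<and>
        (\<forall>t. finite_length (full_sub T (slice T P {t - \<eta> <..< t + \<eta>}))))"

definition semistable :: "('o, 'm, 'x) tricat_scheme \<Rightarrow> (real \<Rightarrow> 'o set) \<Rightarrow> 'o \<Rightarrow> bool" where
  "semistable T P E \<longleftrightarrow> \<not> zero_obj T E \<and> (\<exists>\<phi>. E \<in> P \<phi>)"

definition phase :: "(real \<Rightarrow> 'o set) \<Rightarrow> 'o \<Rightarrow> real" where
  "phase P E = (THE \<phi>. E \<in> P \<phi>)"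

definition bridgeland_stability ::
  "('o, 'm, 'x) tricat_scheme \<Rightarrow> (real \<Rightarrow> 'o set) \<Rightarrow> (('o \<Rightarrow>\<^sub>0 int) set \<Rightarrow> complex) \<Rightarrow> bool" where
  "bridgeland_stability T P Z \<longleftrightarrow>
     slicing T P \<and> Z \<in> hom (K0 T) complex_group \<and>
     (\<forall>\<phi>. \<forall>E \<in> P \<phi>. \<not> zero_obj T E \<longrightarrow>
        (\<exists>m > 0. Z (K0_class T E) = of_real m * exp (\<i> * of_real (pi * \<phi>))))"

text \<open>A free abelian group of rank \<open>n\<close> is taken in the form \<open>\<Lambda> = \<int>\<^sup>n = free_Abelian_group {..<n}\<close>;
  then \<open>\<Lambda> \<otimes> \<real>\<close> is the space of real functions vanishing outside \<open>{..<n}\<close>.\<close>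

definition lattice_space :: "nat \<Rightarrow> (nat \<Rightarrow> real) set" where
  "lattice_space n = {v. \<forall>i \<ge> n. v i = 0}"

definition lattice_vec :: "(nat \<Rightarrow>\<^sub>0 int) \<Rightarrow> nat \<Rightarrow> real" where
  "lattice_vec x = (\<lambda>i. of_int (Poly_Mapping.lookup x i))"

definition lattice_norm :: "nat \<Rightarrow> ((nat \<Rightarrow> real) \<Rightarrow> real) \<Rightarrow> bool" where
  "lattice_norm n N \<longleftrightarrow>
     (\<forall>v \<in> lattice_space n. N v \<ge> 0 \<and> (N v = 0 \<longleftrightarrow> v = (\<lambda>i. 0))) \<and>
     (\<forall>c. \<forall>v \<in> lattice_space n. N (\<lambda>i. c * v i) = \<bar>c\<bar> * N v) \<and>
     (\<forall>v \<in> lattice_space n. \<forall>w \<in> lattice_space n. N (\<lambda>i. v i + w i) \<le> N v + N w)"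

definition support_property ::
  "('o, 'm, 'x) tricat_scheme \<Rightarrow> (real \<Rightarrow> 'o set) \<Rightarrow> (('o \<Rightarrow>\<^sub>0 int) set \<Rightarrow> complex) \<Rightarrow> bool" where
  "support_property T P Z \<longleftrightarrow>
     (\<exists>(n :: nat) u z N (c :: real).
        u \<in> hom (K0 T) (free_Abelian_group {..<n}) \<and>
        z \<in> hom (free_Abelian_group {..<n}) complex_group \<and>
        (\<forall>x \<in> carrier (K0 T). Z x = z (u x)) \<and>
        lattice_norm n N \<and> c > 0 \<and>
        (\<forall>E. semistable T P E \<longrightarrow>
           N (lattice_vec (u (K0_class T E))) \<le> c * cmod (Z (K0_class T E))))"

definition stability_condition ::
  "('o, 'm, 'x) tricat_scheme \<Rightarrow> (real \<Rightarrow> 'o set) \<Rightarrow> (('o \<Rightarrow>\<^sub>0 int) set \<Rightarrow> complex) \<Rightarrow> bool" where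
  "stability_condition T P Z \<longleftrightarrow>
     bridgeland_stability T P Z \<and> locally_finite T P \<and> support_property T P Z"

definition heart :: "('o, 'm, 'x) tricat_scheme \<Rightarrow> (real \<Rightarrow> 'o set) \<Rightarrow> 'o set" where
  "heart T P = slice T P {0 <.. 1}"

definition gl :: "('o, 'm, 'x) tricat_scheme \<Rightarrow> 'o set \<Rightarrow> 'o set \<Rightarrow> 'o set" where
  "gl T \<A>\<^sub>0 \<B>\<^sub>0 = ext_closure T (\<A>\<^sub>0 \<union> \<B>\<^sub>0)"

text \<open>Meaningful under the first compatibility condition, when the full subcategory on
  \<open>gl T \<A>\<^sub>0 \<B>\<^sub>0\<close> is the heart of a t-structure, hence abelian.\<close>

definition M0 :: "('o, 'm, 'x) tricat_scheme \<Rightarrow> 'o set \<Rightarrow> 'o set \<Rightarrow> 'o \<Rightarrow> 'o \<Rightarrow> ('m \<times> 'm) set set" where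
  "M0 T \<A>\<^sub>0 \<B>\<^sub>0 A B = Ext1 (full_sub T (gl T \<A>\<^sub>0 \<B>\<^sub>0)) A B"

definition M0_vanishes :: "('o, 'm, 'x) tricat_scheme \<Rightarrow> 'o set \<Rightarrow> 'o set \<Rightarrow> 'o \<Rightarrow> 'o \<Rightarrow> bool" where
  "M0_vanishes T \<A>\<^sub>0 \<B>\<^sub>0 A B \<longleftrightarrow>
     M0 T \<A>\<^sub>0 \<B>\<^sub>0 A B = {Ext1_zero (full_sub T (gl T \<A>\<^sub>0 \<B>\<^sub>0)) A B}"

end

theory Submission
  imports Defs
begin

text \<open>For each fixed \<open>\<alpha>\<close> the two conditions are equivalent. By (CP1) and shifting, (CP2) reduces to
  \<open>Hom(A, B[1]) = 0\<close> for semistable \<open>A\<close>, \<open>B\<close> in the hearts with \<open>\<phi>(B) \<le> \<alpha> < \<phi>(A)\<close>, so it remains to see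
  that this vanishing is equivalent to that of the Yoneda group \<open>Ext\<^sup>1(A, B)\<close> of \<open>G = gl(\<A>\<^sub>0, \<B>\<^sub>0)\<close>. Since
  \<open>Hom(G, G[-1]) = 0\<close>, an arrow \<open>A \<rightarrow> B[1]\<close> completes to a triangle that is short exact in \<open>G\<close>, and it is
  zero when this sequence splits. Conversely, every object of \<open>G\<close> is an extension of an object on the
  \<open>\<A>\<close>-side by one on the \<open>\<B>\<close>-side, and for the middle term of a short exact sequence
  \<open>0 \<rightarrow> B \<rightarrow> E \<rightarrow> A \<rightarrow> 0\<close> semiorthogonality identifies this triangle with the sequence.\<close>

text \<open>Full subcategories are not assumed closed under isomorphism, and each heart is an
  extension closure formed inside its own component. So \<open>\<A>\<^sub>0\<close> and
  \<open>\<B>\<^sub>0\<close> need not be closed under extensions in \<open>T\<close>, and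
  regrouping iterated extensions with the octahedral axiom can leave them. They are therefore
  enlarged inside \<open>G\<close> to classes cut out by orthogonality to all shifts, which are
  closed under extensions by construction. The vanishing of Hom(G, G[-1]) matters because a triangle
  only gives weak kernels and cokernels: factorizations exist, but two of them may differ by an
  arrow through a shift of an outer term. The vanishing removes this ambiguity and makes the
  triangle short exact. In (CP2) the interval \<alpha> < \<phi> \<le> \<alpha> + 1 consists of the
  phases in (\<alpha>, 1] and of the shifts by 1 of the phases in (0, \<alpha>]. Only an A of the
  first kind and a shifted B of the second, in degree 0, lead to a Hom in degree 1 between the
  hearts; every other combination falls under (CP1).\<close>

lemma Hom_iff: "f \<in> Hom C X Y \<longleftrightarrow> f \<in> Arr C \<and> Dom C f = X \<and> Cod C f = Y"
  by (auto simp: Hom_def)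

text \<open>Vanishing without the claim that \<open>ZeroM C X Y\<close> is itself an arrow from X to
  Y, so that it can be stated with no side condition on the objects.\<close>

definition Hom_zero :: "('o, 'm, 'x) cat_scheme \<Rightarrow> 'o \<Rightarrow> 'o \<Rightarrow> bool" where
  "Hom_zero C X Y \<longleftrightarrow> (\<forall>f \<in> Hom C X Y. f = ZeroM C X Y)"

lemma Hom_zeroD: "Hom_zero C X Y \<Longrightarrow> f \<in> Hom C X Y \<Longrightarrow> f = ZeroM C X Y"
  by (simp add: Hom_zero_def)

lemma full_sub_simps [simp]:
  "Ob (full_sub C S) = S" "Dom (full_sub C S) = Dom C" "Cod (full_sub C S) = Cod C"
  "Ident (full_sub C S) = Ident C" "Comp (full_sub C S) = Comp C"
  "AddM (full_sub C S) = AddM C" "ZeroM (full_sub C S) = ZeroM C"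
  by (simp_all add: full_sub_def)

lemma Hom_full_sub: "Hom (full_sub C S) X Y = (if X \<in> S \<and> Y \<in> S then Hom C X Y else {})"
  by (auto simp: full_sub_def Hom_def)

lemma Hom_full_subD: "f \<in> Hom (full_sub C S) X Y \<Longrightarrow> X \<in> S \<and> Y \<in> S \<and> f \<in> Hom C X Y"
  by (simp add: Hom_full_sub split: if_splits)

lemma Arr_full_sub: "f \<in> Arr (full_sub C S) \<longleftrightarrow> f \<in> Arr C \<and> Dom C f \<in> S \<and> Cod C f \<in> S"
  by (auto simp: full_sub_def)

section \<open>Preadditive categories and split extensions\<close>

context category
begin

lemma Hom_Ob: "f \<in> Hom C X Y \<Longrightarrow> X \<in> Ob C" "f \<in> Hom C X Y \<Longrightarrow> Y \<in> Ob C"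
  using Dom_in_Ob Cod_in_Ob by (auto simp: Hom_iff)

lemma category_full_sub:
  assumes "S \<subseteq> Ob C"
  shows "category (full_sub C S)"
  using assms
  apply unfold_locales
        apply (simp add: Arr_full_sub)
       apply (simp add: Arr_full_sub)
      apply (simp add: Hom_full_sub Ident_in_Hom subset_iff)
     apply (clarsimp dest!: Hom_full_subD, simp add: Hom_full_sub, rule Comp_in_Hom, assumption+)
    apply (clarsimp dest!: Hom_full_subD, rule Comp_Ident_left, assumption)
   apply (clarsimp dest!: Hom_full_subD, rule Comp_Ident_right, assumption)
  apply (clarsimp dest!: Hom_full_subD, rule Comp_assoc, assumption+)
  done

end

context preadditive_category
begin

lemma preadditive_full_sub:
  assumes "S \<subseteq> Ob C"
  shows "preadditive_category (full_sub C S)"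
  using assms
  apply (intro preadditive_category.intro preadditive_category_axioms.intro category_full_sub)
     apply assumption
    apply (use Hom_comm_group in \<open>simp add: Hom_group_def Hom_full_sub subset_iff\<close>)
   apply (clarsimp dest!: Hom_full_subD, rule Comp_AddM_left, assumption+)
  apply (clarsimp dest!: Hom_full_subD, rule Comp_AddM_right, assumption+)
  done

lemma Zero_in_Hom: "X \<in> Ob C \<Longrightarrow> Y \<in> Ob C \<Longrightarrow> ZeroM C X Y \<in> Hom C X Y"
  using monoid.one_closed[OF group.is_monoid, OF comm_group.axioms(2), OF Hom_comm_group, of X Y]
  by (simp add: Hom_group_def)

lemma Add_in_Hom: "f \<in> Hom C X Y \<Longrightarrow> g \<in> Hom C X Y \<Longrightarrow> AddM C f g \<in> Hom C X Y"
  using monoid.m_closed[OF group.is_monoid, OF comm_group.axioms(2), OF Hom_comm_group, of X Y f g]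
    Hom_Ob[of f X Y]
  by (simp add: Hom_group_def)

lemma Neg_in_Hom: "f \<in> Hom C X Y \<Longrightarrow> NegM C f \<in> Hom C X Y"
  using group.inv_closed[OF comm_group.axioms(2), OF Hom_comm_group, of X Y f] Hom_Ob[of f X Y]
  by (simp add: Hom_group_def NegM_def Hom_iff)

lemma Add_Zero_right: "f \<in> Hom C X Y \<Longrightarrow> AddM C f (ZeroM C X Y) = f"
  using monoid.r_one[OF group.is_monoid, OF comm_group.axioms(2), OF Hom_comm_group, of X Y f]
    Hom_Ob[of f X Y]
  by (simp add: Hom_group_def)

lemma Add_Zero_left: "f \<in> Hom C X Y \<Longrightarrow> AddM C (ZeroM C X Y) f = f"
  using monoid.l_one[OF group.is_monoid, OF comm_group.axioms(2), OF Hom_comm_group, of X Y f]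
    Hom_Ob[of f X Y]
  by (simp add: Hom_group_def)

lemma Add_Neg_right: "f \<in> Hom C X Y \<Longrightarrow> AddM C f (NegM C f) = ZeroM C X Y"
  using group.r_inv[OF comm_group.axioms(2), OF Hom_comm_group, of X Y f] Hom_Ob[of f X Y]
  by (simp add: Hom_group_def NegM_def Hom_iff)

lemma Add_Neg_left: "f \<in> Hom C X Y \<Longrightarrow> AddM C (NegM C f) f = ZeroM C X Y"
  using group.l_inv[OF comm_group.axioms(2), OF Hom_comm_group, of X Y f] Hom_Ob[of f X Y]
  by (simp add: Hom_group_def NegM_def Hom_iff)

lemma Neg_unique:
  "f \<in> Hom C X Y \<Longrightarrow> g \<in> Hom C X Y \<Longrightarrow> AddM C g f = ZeroM C X Y \<Longrightarrow> NegM C f = g"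
  using group.inv_equality[OF comm_group.axioms(2), OF Hom_comm_group, of X Y g f] Hom_Ob[of f X Y]
  by (simp add: Hom_group_def NegM_def Hom_iff)

lemma Add_assoc:
  "f \<in> Hom C X Y \<Longrightarrow> g \<in> Hom C X Y \<Longrightarrow> h \<in> Hom C X Y \<Longrightarrow>
    AddM C (AddM C f g) h = AddM C f (AddM C g h)"
  using monoid.m_assoc[OF group.is_monoid, OF comm_group.axioms(2), OF Hom_comm_group, of X Y f g h]
    Hom_Ob[of f X Y]
  by (simp add: Hom_group_def)

text \<open>Cancellation in the Hom-group. Additivity of composition and of the shift yields exactly
  the equation f + f = f for the image f of a zero arrow.\<close>

lemma Zero_unique: "f \<in> Hom C X Y \<Longrightarrow> AddM C f f = f \<Longrightarrow> f = ZeroM C X Y"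
  using Add_assoc[of f X Y f "NegM C f"] Add_Neg_right[of f X Y] Add_Zero_right[of f X Y]
    Neg_in_Hom[of f X Y] by simp

lemma Comp_Zero_left: "f \<in> Hom C X Y \<Longrightarrow> Z \<in> Ob C \<Longrightarrow> ZeroM C Y Z \<star> f = ZeroM C X Z"
  using Comp_AddM_left[of f X Y "ZeroM C Y Z" Z "ZeroM C Y Z"] Hom_Ob(2)[of f X Y]
    Add_Zero_left[of "ZeroM C Y Z" Y Z]
  by (intro Zero_unique) (simp_all add: Comp_in_Hom[of f X Y] Zero_in_Hom)

lemma Comp_Zero_right: "g \<in> Hom C Y Z \<Longrightarrow> X \<in> Ob C \<Longrightarrow> g \<star> ZeroM C X Y = ZeroM C X Z"
  using Comp_AddM_right[of "ZeroM C X Y" X Y "ZeroM C X Y" g Z] Hom_Ob(1)[of g Y Z]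
    Add_Zero_left[of "ZeroM C X Y" X Y]
  by (intro Zero_unique) (simp_all add: Comp_in_Hom[of _ X Y] Zero_in_Hom)

lemma Comp_Neg_left:
  assumes "f \<in> Hom C X Y" "g \<in> Hom C Y Z"
  shows "NegM C g \<star> f = NegM C (g \<star> f)"
proof -
  have "Z \<in> Ob C" using assms Hom_Ob by blast
  then have "AddM C (NegM C g \<star> f) (g \<star> f) = ZeroM C X Z"
    using Comp_AddM_left[OF assms(1) Neg_in_Hom[OF assms(2)] assms(2)] Add_Neg_left[OF assms(2)]
      Comp_Zero_left[OF assms(1)] by simp
  then show ?thesis
    using Neg_unique[OF Comp_in_Hom[OF assms] Comp_in_Hom[OF assms(1) Neg_in_Hom[OF assms(2)]]]
    by simp
qed

lemma Comp_Neg_right: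
  assumes "f \<in> Hom C X Y" "g \<in> Hom C Y Z"
  shows "g \<star> NegM C f = NegM C (g \<star> f)"
proof -
  have "X \<in> Ob C" using assms Hom_Ob by blast
  then have "AddM C (g \<star> NegM C f) (g \<star> f) = ZeroM C X Z"
    using Comp_AddM_right[OF Neg_in_Hom[OF assms(1)] assms] Add_Neg_left[OF assms(1)]
      Comp_Zero_right[OF assms(2)] by simp
  then show ?thesis
    using Neg_unique[OF Comp_in_Hom[OF assms] Comp_in_Hom[OF Neg_in_Hom[OF assms(1)] assms(2)]]
    by simp
qed

lemma Neg_Neg: "f \<in> Hom C X Y \<Longrightarrow> NegM C (NegM C f) = f"
  by (meson Add_Neg_right Neg_in_Hom Neg_unique)

lemma Neg_Zero: "X \<in> Ob C \<Longrightarrow> Y \<in> Ob C \<Longrightarrow> NegM C (ZeroM C X Y) = ZeroM C X Y"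
  by (meson Add_Zero_left Neg_unique Zero_in_Hom)

lemma eq_if_diff_Zero:
  assumes "f \<in> Hom C X Y" "g \<in> Hom C X Y" "AddM C f (NegM C g) = ZeroM C X Y"
  shows "f = g"
  using Neg_unique[OF Neg_in_Hom[OF assms(2)] assms(1,3)] Neg_Neg[OF assms(2)] by simp

lemma Hom_zero_Ident_left:
  assumes "Ident C X = ZeroM C X X" "X \<in> Ob C"
  shows "Hom_zero C X Y"
  unfolding Hom_zero_def
proof
  fix f assume "f \<in> Hom C X Y"
  from Comp_Ident_right[OF this] Comp_Zero_right[OF this assms(2)] assms(1)
  show "f = ZeroM C X Y" by simp
qed

lemma Hom_zero_Ident_right:
  assumes "Ident C X = ZeroM C X X" "X \<in> Ob C"
  shows "Hom_zero C Y X"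
  unfolding Hom_zero_def
proof
  fix f assume "f \<in> Hom C Y X"
  from Comp_Ident_left[OF this] Comp_Zero_left[OF this assms(2)] assms(1)
  show "f = ZeroM C Y X" by simp
qed

text \<open>\<open>zero_obj\<close> quantifies over all objects of the category, whereas the
  identity criterion looks at X alone. Being zero thus passes between \<open>T\<close> and its full
  subcategories.\<close>

lemma zero_obj_iff: "zero_obj C X \<longleftrightarrow> X \<in> Ob C \<and> Ident C X = ZeroM C X X"
proof
  assume X: "zero_obj C X"
  then have O: "X \<in> Ob C" by (simp add: zero_obj_def)
  with X have "\<exists>!f. f \<in> Hom C X X" by (simp add: zero_obj_def)
  from ex1E[OF this] have "Ident C X = ZeroM C X X"
    using Ident_in_Hom[OF O] Zero_in_Hom[OF O O] by metis
  with O show "X \<in> Ob C \<and> Ident C X = ZeroM C X X" ..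
next
  assume X: "X \<in> Ob C \<and> Ident C X = ZeroM C X X"
  show "zero_obj C X"
    unfolding zero_obj_def
  proof (intro conjI ballI)
    show O: "X \<in> Ob C" using X ..
    fix Y assume Y: "Y \<in> Ob C"
    show "\<exists>!f. f \<in> Hom C X Y"
      using Zero_in_Hom[OF O Y] Hom_zeroD[OF Hom_zero_Ident_left[OF conjunct2[OF X] O]]
      by (rule ex1I)
    show "\<exists>!f. f \<in> Hom C Y X"
      using Zero_in_Hom[OF Y O] Hom_zeroD[OF Hom_zero_Ident_right[OF conjunct2[OF X] O]]
      by (rule ex1I)
  qed
qed

text \<open>\<open>Y'\<close> is a retract of \<open>Y\<close>, so every arrow f into it equals
  \<open>u \<star> (v \<star> f)\<close> and factors through \<open>Y\<close>.\<close>

lemma Hom_zero_split: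
  assumes "u \<in> Hom C Y Y'" "v \<in> Hom C Y' Y" "u \<star> v = Ident C Y'"
    and "Hom_zero C X Y" "X \<in> Ob C"
  shows "Hom_zero C X Y'"
  unfolding Hom_zero_def
proof
  fix f assume f: "f \<in> Hom C X Y'"
  have "f = u \<star> (v \<star> f)"
    using Comp_assoc[OF f assms(2,1)] Comp_Ident_left[OF f] assms(3) by simp
  also have "v \<star> f = ZeroM C X Y"
    using assms f by (meson Comp_in_Hom Hom_zeroD)
  finally show "f = ZeroM C X Y'"
    using assms Comp_Zero_right by simp
qed

section \<open>Kernels, cokernels and the splitting of extensions\<close>

lemma is_kernel_iff:
  assumes "i \<in> Hom C B E" "j \<in> Hom C E A"
  shows "is_kernel C i j \<longleftrightarrow> j \<star> i = ZeroM C B A \<and>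
    (\<forall>W \<in> Ob C. \<forall>w \<in> Hom C W E. j \<star> w = ZeroM C W A \<longrightarrow> (\<exists>!v. v \<in> Hom C W B \<and> i \<star> v = w))"
proof -
  have "i \<in> Arr C" "Dom C i = B" "Cod C i = E" "j \<in> Arr C" "Dom C j = E" "Cod C j = A"
    using assms by (simp_all add: Hom_iff)
  then show ?thesis by (simp add: is_kernel_def)
qed

lemma is_cokernel_iff:
  assumes "i \<in> Hom C B E" "j \<in> Hom C E A"
  shows "is_cokernel C j i \<longleftrightarrow> j \<star> i = ZeroM C B A \<and>
    (\<forall>W \<in> Ob C. \<forall>w \<in> Hom C E W. w \<star> i = ZeroM C B W \<longrightarrow> (\<exists>!v. v \<in> Hom C A W \<and> v \<star> j = w))"
proof -
  have "i \<in> Arr C" "Dom C i = B" "Cod C i = E" "j \<in> Arr C" "Dom C j = E" "Cod C j = A"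
    using assms by (simp_all add: Hom_iff)
  then show ?thesis by (simp add: is_cokernel_def)
qed

lemma kernel_lift:
  assumes "is_kernel C i j" "i \<in> Hom C B E" "j \<in> Hom C E A"
    and "w \<in> Hom C W E" "j \<star> w = ZeroM C W A"
  obtains v where "v \<in> Hom C W B" "i \<star> v = w"
proof -
  have "W \<in> Ob C" using assms Hom_Ob by blast
  then have "\<exists>!v. v \<in> Hom C W B \<and> i \<star> v = w"
    using assms(1,4,5) is_kernel_iff[OF assms(2,3)] by simp
  then show ?thesis using that by blast
qed

lemma cokernel_lift:
  assumes "is_cokernel C j i" "i \<in> Hom C B E" "j \<in> Hom C E A"
    and "w \<in> Hom C E W" "w \<star> i = ZeroM C B W"
  obtains v where "v \<in> Hom C A W" "v \<star> j = w"
proof -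
  have "W \<in> Ob C" using assms Hom_Ob by blast
  then have "\<exists>!v. v \<in> Hom C A W \<and> v \<star> j = w"
    using assms(1,4,5) is_cokernel_iff[OF assms(2,3)] by simp
  then show ?thesis using that by blast
qed

lemma kernel_Comp:
  assumes "is_kernel C i j" "i \<in> Hom C B E" "j \<in> Hom C E A"
  shows "j \<star> i = ZeroM C B A"
  using assms(1) is_kernel_iff[OF assms(2,3)] by simp

lemma kernel_mono:
  assumes k: "is_kernel C i j" and i: "i \<in> Hom C B E" and j: "j \<in> Hom C E A"
    and x: "x \<in> Hom C W B" and y: "y \<in> Hom C W B" and eq: "i \<star> x = i \<star> y"
  shows "x = y"
proof -
  have W: "W \<in> Ob C" "A \<in> Ob C" using x j Hom_Ob by blast+
  have w: "i \<star> x \<in> Hom C W E" using Comp_in_Hom[OF x i] .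
  have "j \<star> (i \<star> x) = ZeroM C W A"
    using Comp_assoc[OF x i j] kernel_Comp[OF k i j] Comp_Zero_left[OF x W(2)] by simp
  then have "\<exists>!v. v \<in> Hom C W B \<and> i \<star> v = i \<star> x"
    using k W(1) w is_kernel_iff[OF i j] by simp
  then show ?thesis using x y eq by auto
qed

lemma cokernel_epi:
  assumes c: "is_cokernel C j i" and i: "i \<in> Hom C B E" and j: "j \<in> Hom C E A"
    and x: "x \<in> Hom C A W" and y: "y \<in> Hom C A W" and eq: "x \<star> j = y \<star> j"
  shows "x = y"
proof -
  have W: "W \<in> Ob C" "B \<in> Ob C" using x i Hom_Ob by blast+
  have w: "x \<star> j \<in> Hom C E W" using Comp_in_Hom[OF j x] .
  have "j \<star> i = ZeroM C B A" using c is_cokernel_iff[OF i j] by simp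
  then have "(x \<star> j) \<star> i = ZeroM C B W"
    using Comp_assoc[OF i j x] Comp_Zero_right[OF x W(2)] by simp
  then have "\<exists>!v. v \<in> Hom C A W \<and> v \<star> j = x \<star> j"
    using c W(1) w is_cokernel_iff[OF i j] by simp
  then show ?thesis using x y eq by auto
qed

text \<open>The arrow id - s j is killed by \<open>j\<close>, hence lifts through the kernel to
  \<open>i \<star> r\<close>. The remaining biproduct identities hold after composing with
  \<open>i\<close>, which is a monomorphism.\<close>

lemma split_retraction:
  assumes ex: "(i, j) \<in> extensions C A B" and s: "s \<in> Hom C A (Dom C j)" "j \<star> s = Ident C A"
  obtains E r where "i \<in> Hom C B E" "j \<in> Hom C E A" "s \<in> Hom C A E" "r \<in> Hom C E B"
    "j \<star> i = ZeroM C B A" "r \<star> i = Ident C B" "r \<star> s = ZeroM C A B"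
    "AddM C (i \<star> r) (s \<star> j) = Ident C E"
proof -
  define E where "E = Dom C j"
  have k: "is_kernel C i j" and DC: "Dom C i = B" "Cod C j = A"
    using ex by (simp_all add: extensions_def short_exact_def)
  then have i: "i \<in> Hom C B E" and j: "j \<in> Hom C E A"
    by (simp_all add: is_kernel_def Hom_iff E_def)
  have s': "s \<in> Hom C A E" using s E_def by simp
  have ji: "j \<star> i = ZeroM C B A" using kernel_Comp[OF k i j] .
  have obs: "A \<in> Ob C" "B \<in> Ob C" "E \<in> Ob C" using i j Hom_Ob by blast+
  have mono: "x = y" if "x \<in> Hom C W B" "y \<in> Hom C W B" "i \<star> x = i \<star> y" for W x y
    using kernel_mono[OF k i j that] .
  let ?w = "AddM C (Ident C E) (NegM C (s \<star> j))"
  have sj: "s \<star> j \<in> Hom C E E" using Comp_in_Hom j s' by blast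
  have w: "?w \<in> Hom C E E" using sj Add_in_Hom Ident_in_Hom Neg_in_Hom obs by blast
  have E: "Ident C E \<in> Hom C E E" and nsj: "NegM C (s \<star> j) \<in> Hom C E E"
    using Ident_in_Hom[OF obs(3)] Neg_in_Hom[OF sj] by auto
  have jsj: "j \<star> (s \<star> j) = j"
    using s(2) Comp_assoc[OF j s' j] Comp_Ident_left[OF j] by simp
  have "j \<star> ?w = ZeroM C E A"
    using Comp_AddM_right[OF E nsj j] Comp_Ident_right[OF j] Comp_Neg_right[OF sj j] jsj
      Add_Neg_right[OF j] by simp
  then obtain r where r: "r \<in> Hom C E B" "i \<star> r = ?w"
    using kernel_lift[OF k i j w] by blast
  have sum: "AddM C (i \<star> r) (s \<star> j) = Ident C E"
    using r(2) Add_assoc[OF E nsj sj] Add_Neg_left[OF sj] Add_Zero_right[OF E] by simp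
  have w_Comp: "?w \<star> x = AddM C x (NegM C (s \<star> (j \<star> x)))" if x: "x \<in> Hom C W E" for x W
    using Comp_AddM_left[OF x E nsj] Comp_Ident_left[OF x] Comp_Neg_left[OF x sj]
      Comp_assoc[OF x j s'] by simp
  have "i \<star> (r \<star> i) = i"
    using Comp_assoc[OF i r(1) i] r(2) w_Comp[OF i] ji Comp_Zero_right[OF s' obs(2)]
      Neg_Zero[OF obs(2,3)] Add_Zero_right[OF i] by simp
  then have ri: "r \<star> i = Ident C B"
    using mono[OF Comp_in_Hom[OF i r(1)] Ident_in_Hom[OF obs(2)]] Comp_Ident_right[OF i] by simp
  have "i \<star> (r \<star> s) = ZeroM C A E"
    using Comp_assoc[OF s' r(1) i] r(2) w_Comp[OF s'] s(2) Comp_Ident_right[OF s']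
      Add_Neg_right[OF s'] by simp
  then have rs: "r \<star> s = ZeroM C A B"
    using mono[OF Comp_in_Hom[OF s' r(1)] Zero_in_Hom[OF obs(1,2)]] Comp_Zero_right[OF i obs(1)]
    by simp
  show ?thesis using that i j s' r(1) ji ri rs sum by blast
qed

text \<open>Both middle terms are biproducts of B and A. The comparison sends \<open>i\<close> to
  \<open>i'\<close> and \<open>s\<close> to \<open>s'\<close>, which forces the formula i' r + s'
  j.\<close>

lemma split_extension_equiv:
  assumes "(i, j) \<in> extensions C A B" "s \<in> Hom C A (Dom C j)" "j \<star> s = Ident C A"
    and "(i', j') \<in> extensions C A B" "s' \<in> Hom C A (Dom C j')" "j' \<star> s' = Ident C A"
  shows "((i, j), (i', j')) \<in> extension_equiv C A B"
proof -
  obtain E r where E: "i \<in> Hom C B E" "j \<in> Hom C E A" "s \<in> Hom C A E" "r \<in> Hom C E B"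
    "j \<star> i = ZeroM C B A" "r \<star> i = Ident C B" "r \<star> s = ZeroM C A B"
    "AddM C (i \<star> r) (s \<star> j) = Ident C E"
    using split_retraction[OF assms(1-3)] by blast
  obtain E' r' where E': "i' \<in> Hom C B E'" "j' \<in> Hom C E' A" "s' \<in> Hom C A E'" "r' \<in> Hom C E' B"
    "j' \<star> i' = ZeroM C B A" "r' \<star> i' = Ident C B" "r' \<star> s' = ZeroM C A B"
    "AddM C (i' \<star> r') (s' \<star> j') = Ident C E'"
    using split_retraction[OF assms(4-6)] by blast
  have obs: "A \<in> Ob C" "B \<in> Ob C" "E \<in> Ob C" "E' \<in> Ob C" using E(1,2) E'(1) Hom_Ob by blast+
  \<comment> \<open>The arrow that passes through the sum of B and A, with \<open>r\<close>,
    \<open>j\<close> leading in and \<open>i\<close>, \<open>s\<close> leading out. Composition acts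
    only on the outer entries, so the comparison, its inverse and both identities are instances of
    one formula.\<close>
  define d where "d i s r j = AddM C (i \<star> r) (s \<star> j)" for i s r j
  have d_Hom: "d i s r j \<in> Hom C X Y"
    if "i \<in> Hom C B Y" "s \<in> Hom C A Y" "r \<in> Hom C X B" "j \<in> Hom C X A" for i s r j X Y
    unfolding d_def using that by (meson Add_in_Hom Comp_in_Hom)
  have d_left: "x \<star> d i s r j = d (x \<star> i) (x \<star> s) r j"
    if "i \<in> Hom C B Y" "s \<in> Hom C A Y" "r \<in> Hom C X B" "j \<in> Hom C X A" "x \<in> Hom C Y Y'"
    for i s r j x X Y Y'
    using Comp_AddM_right[OF Comp_in_Hom[OF that(3,1)] Comp_in_Hom[OF that(4,2)] that(5)]
      Comp_assoc[OF that(3,1,5)] Comp_assoc[OF that(4,2,5)] by (simp add: d_def)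
  have d_right: "d i s r j \<star> x = d i s (r \<star> x) (j \<star> x)"
    if "i \<in> Hom C B Y" "s \<in> Hom C A Y" "r \<in> Hom C X B" "j \<in> Hom C X A" "x \<in> Hom C X' X"
    for i s r j x X Y X'
    using Comp_AddM_left[OF that(5) Comp_in_Hom[OF that(3,1)] Comp_in_Hom[OF that(4,2)]]
      Comp_assoc[OF that(5,3,1)] Comp_assoc[OF that(5,4,2)] by (simp add: d_def)
  have d_i: "d i s (Ident C B) (ZeroM C B A) = i" if "i \<in> Hom C B Y" "s \<in> Hom C A Y" for i s Y
    using Comp_Ident_right[OF that(1)] Comp_Zero_right[OF that(2) obs(2)] Add_Zero_right[OF that(1)]
    by (simp add: d_def)
  have d_s: "d i s (ZeroM C A B) (Ident C A) = s" if "i \<in> Hom C B Y" "s \<in> Hom C A Y" for i s Y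
    using Comp_Ident_right[OF that(2)] Comp_Zero_right[OF that(1) obs(1)] Add_Zero_left[OF that(2)]
    by (simp add: d_def)
  have d_j: "d (ZeroM C B A) (Ident C A) r j = j" if "r \<in> Hom C X B" "j \<in> Hom C X A" for r j X
    using Comp_Ident_left[OF that(2)] Comp_Zero_left[OF that(1) obs(1)] Add_Zero_left[OF that(2)]
    by (simp add: d_def)
  let ?e = "d i' s' r j" and ?e' = "d i s r' j'"
  have e: "?e \<in> Hom C E E'" "?e' \<in> Hom C E' E" using d_Hom E E' by blast+
  have ei: "?e \<star> i = i'" and es: "?e \<star> s = s'"
    using d_right[OF E'(1,3) E(4,2)] E assms(3) d_i[OF E'(1,3)] d_s[OF E'(1,3)] by simp_all
  have ei': "?e' \<star> i' = i" and es': "?e' \<star> s' = s"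
    using d_right[OF E(1,3) E'(4,2)] E' assms(6) d_i[OF E(1,3)] d_s[OF E(1,3)] by simp_all
  have je: "j' \<star> ?e = j"
    using d_left[OF E'(1,3) E(4,2) E'(2)] E'(5) assms(6) d_j[OF E(4,2)] by simp
  have "?e' \<star> ?e = d i s r j" using d_left[OF E'(1,3) E(4,2) e(2)] ei' es' by simp
  then have 1: "?e' \<star> ?e = Ident C E" using E(8) by (simp add: d_def)
  have "?e \<star> ?e' = d i' s' r' j'" using d_left[OF E(1,3) E'(4,2) e(1)] ei es by simp
  then have 2: "?e \<star> ?e' = Ident C E'" using E'(8) by (simp add: d_def)
  have "iso_arrow C ?e" using e 1 2 by (auto simp: iso_arrow_def Hom_iff)
  then show ?thesis
    unfolding extension_equiv_def using assms(1,4) e(1) ei je E(1) E'(1) by (auto simp: Hom_iff)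
qed

text \<open>If there were no extension at all, \<open>Ext1\<close> would be empty and so differ from
  the singleton of the zero class, while the right-hand side would hold vacuously. This case is
  excluded by assumption.\<close>

lemma Ext1_eq_zero_iff:
  assumes "extensions C A B \<noteq> {}"
  shows "Ext1 C A B = {Ext1_zero C A B} \<longleftrightarrow>
    (\<forall>(i, j) \<in> extensions C A B. \<exists>s \<in> Hom C A (Dom C j). j \<star> s = Ident C A)"
    (is "?L \<longleftrightarrow> ?R")
proof
  assume L: ?L
  show ?R
  proof clarify
    fix i j assume ij: "(i, j) \<in> extensions C A B"
    then have E: "Cod C i \<in> Ob C" "i \<in> Hom C (Dom C i) (Cod C i)" "j \<in> Hom C (Cod C i) (Cod C j)"
      by (auto simp: extensions_def short_exact_def is_kernel_def Hom_iff Cod_in_Ob Dom_in_Ob)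
    then have "iso_arrow C (Ident C (Cod C i))"
      using Ident_in_Hom[of "Cod C i"] Comp_Ident_left[of "Ident C (Cod C i)" "Cod C i" "Cod C i"]
      unfolding iso_arrow_def by (auto simp: Hom_iff intro!: bexI[of _ "Ident C (Cod C i)"])
    \<comment> \<open>By reflexivity the extension lies in its own class, and that class can only be
      the zero class.\<close>
    then have "((i, j), (i, j)) \<in> extension_equiv C A B"
      unfolding extension_equiv_def using ij E
      by (auto intro!: bexI[of _ "Ident C (Cod C i)"] Comp_Ident_left Comp_Ident_right Ident_in_Hom)
    moreover have "extension_equiv C A B `` {(i, j)} \<in> Ext1 C A B"
      using ij by (auto simp: Ext1_def quotient_def)
    ultimately have "(i, j) \<in> Ext1_zero C A B" using L by auto
    then show "\<exists>s \<in> Hom C A (Dom C j). j \<star> s = Ident C A" by (auto simp: Ext1_zero_def)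
  qed
next
  assume R: ?R
  \<comment> \<open>When everything splits, every class is the set of all extensions.\<close>
  have "extension_equiv C A B `` {(i, j)} = Ext1_zero C A B" if "(i, j) \<in> extensions C A B" for i j
  proof (intro equalityI subsetI)
    fix p assume "p \<in> extension_equiv C A B `` {(i, j)}"
    then have "p \<in> extensions C A B" by (auto simp: extension_equiv_def)
    then show "p \<in> Ext1_zero C A B" using R by (auto simp: Ext1_zero_def)
  next
    fix p assume "p \<in> Ext1_zero C A B"
    then show "p \<in> extension_equiv C A B `` {(i, j)}"
      using R that split_extension_equiv unfolding Ext1_zero_def by blast
  qed
  then show ?L unfolding Ext1_def quotient_def using assms by auto
qed

end

section \<open>Triangulated categories and extension closures\<close>

context triangulated_category
begin

section \<open>Shifts and rotations of triangles\<close>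

lemma ShO_cancel:
  assumes "X \<in> Ob T"
  shows "ShO T n (ShO T (- n) X) = X" "ShO T (- n) (ShO T n X) = X"
  unfolding ShO_add[OF assms, symmetric] by (simp_all add: ShO_0[OF assms])

lemma ShA_cancel:
  assumes "f \<in> Arr T"
  shows "ShA T n (ShA T (- n) f) = f" "ShA T (- n) (ShA T n f) = f"
  unfolding ShA_add[OF assms, symmetric] by (simp_all add: ShA_0[OF assms])

lemma ShA_Zero:
  assumes "X \<in> Ob T" "Y \<in> Ob T"
  shows "ShA T n (ZeroM T X Y) = ZeroM T (ShO T n X) (ShO T n Y)"
proof -
  note Z = Zero_in_Hom[OF assms]
  show ?thesis
    using Zero_unique[OF ShA_in_Hom[OF Z]] ShA_AddM[OF Z Z, of n] Add_Zero_left[OF Z] by simp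
qed

lemma ShA_Neg:
  assumes f: "f \<in> Hom T X Y"
  shows "ShA T n (NegM T f) = NegM T (ShA T n f)"
proof -
  note nf = Neg_in_Hom[OF f]
  show ?thesis
    using Neg_unique[OF ShA_in_Hom[OF f] ShA_in_Hom[OF nf], of n] ShA_AddM[OF nf f, of n]
      Add_Neg_left[OF f] ShA_Zero[OF Hom_Ob(1)[OF f] Hom_Ob(2)[OF f], of n] by simp
qed

lemma ShA_eq_iff:
  assumes "f \<in> Arr T" "g \<in> Arr T"
  shows "ShA T n f = ShA T n g \<longleftrightarrow> f = g"
proof
  assume "ShA T n f = ShA T n g"
  then have "ShA T (- n) (ShA T n f) = ShA T (- n) (ShA T n g)" by (rule arg_cong)
  then show "f = g" by (simp add: ShA_cancel assms)
qed simp

lemma Hom_zero_ShO: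
  assumes X: "X \<in> Ob T" and Y: "Y \<in> Ob T"
  shows "Hom_zero T (ShO T n X) (ShO T n Y) \<longleftrightarrow> Hom_zero T X Y"
proof
  assume *: "Hom_zero T (ShO T n X) (ShO T n Y)"
  show "Hom_zero T X Y"
    unfolding Hom_zero_def
  proof
    fix f assume f: "f \<in> Hom T X Y"
    have "ShA T n f = ShA T n (ZeroM T X Y)"
      using Hom_zeroD[OF * ShA_in_Hom[OF f]] ShA_Zero[OF X Y] by simp
    then show "f = ZeroM T X Y"
      using ShA_eq_iff f Zero_in_Hom[OF X Y] by (simp add: Hom_iff)
  qed
next
  assume *: "Hom_zero T X Y"
  show "Hom_zero T (ShO T n X) (ShO T n Y)"
    unfolding Hom_zero_def
  proof
    fix f assume f: "f \<in> Hom T (ShO T n X) (ShO T n Y)"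
    have "ShA T (- n) f \<in> Hom T X Y"
      using ShA_in_Hom[OF f, of "- n"] by (simp add: ShO_cancel X Y)
    then have "ShA T n (ShA T (- n) f) = ZeroM T (ShO T n X) (ShO T n Y)"
      using Hom_zeroD[OF *] ShA_Zero[OF X Y] by simp
    then show "f = ZeroM T (ShO T n X) (ShO T n Y)"
      using ShA_cancel(1) f by (simp add: Hom_iff)
  qed
qed

lemma Hom_zero_ShO_left:
  assumes X: "X \<in> Ob T" and Y: "Y \<in> Ob T"
  shows "Hom_zero T (ShO T n X) Y \<longleftrightarrow> Hom_zero T X (ShO T (- n) Y)"
  using Hom_zero_ShO[OF X ShO_in_Ob[OF Y], of n "- n"] ShO_cancel(1)[OF Y] by simp

lemma rotate:
  assumes "(f, g, h) \<in> Tri T" "f \<in> Hom T X Y" "g \<in> Hom T Y Z" "h \<in> Hom T Z (ShO T 1 X)"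
  shows "(g, h, NegM T (ShA T 1 f)) \<in> Tri T"
    "NegM T (ShA T 1 f) \<in> Hom T (ShO T 1 X) (ShO T 1 Y)"
  using assms TR2 Neg_in_Hom[OF ShA_in_Hom[OF assms(2)]] by blast+

text \<open>\<open>TR2\<close> read from right to left: rotating the triangle that starts with
  -h[-1] produces the third arrow -(-h) = h.\<close>

lemma rotate_back:
  assumes t: "(f, g, h) \<in> Tri T"
    and f: "f \<in> Hom T X Y" and g: "g \<in> Hom T Y Z" and h: "h \<in> Hom T Z (ShO T 1 X)"
  shows "(NegM T (ShA T (- 1) h), f, g) \<in> Tri T"
    "NegM T (ShA T (- 1) h) \<in> Hom T (ShO T (- 1) Z) X"
    "g \<in> Hom T Y (ShO T 1 (ShO T (- 1) Z))"
proof -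
  have X: "X \<in> Ob T" and Z: "Z \<in> Ob T" using Hom_Ob(1)[OF f] Hom_Ob(2)[OF g] by auto
  have h': "ShA T (- 1) h \<in> Hom T (ShO T (- 1) Z) X"
    using ShA_in_Hom[OF h, of "- 1"] ShO_cancel(2)[OF X] by simp
  show k: "NegM T (ShA T (- 1) h) \<in> Hom T (ShO T (- 1) Z) X" using Neg_in_Hom[OF h'] .
  show g': "g \<in> Hom T Y (ShO T 1 (ShO T (- 1) Z))" using g ShO_cancel(1)[OF Z] by simp
  have "NegM T (ShA T 1 (NegM T (ShA T (- 1) h))) = NegM T (NegM T (ShA T 1 (ShA T (- 1) h)))"
    using ShA_Neg[OF h', of 1] by simp
  also have "\<dots> = h"
    using ShA_cancel(1)[of h 1] Neg_Neg[OF h] h by (simp add: Hom_iff)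
  finally show "(NegM T (ShA T (- 1) h), f, g) \<in> Tri T"
    using TR2[OF k f g'] t by simp
qed

lemma dist_triangleI:
  assumes "(f, g, h) \<in> Tri T" "f \<in> Hom T X Y" "g \<in> Hom T Y Z"
  shows "dist_triangle T X Y Z"
proof -
  obtain X' Y' Z' where "f \<in> Hom T X' Y'" "g \<in> Hom T Y' Z'" "h \<in> Hom T Z' (ShO T 1 X')"
    using Tri_wf[OF assms(1)] by blast
  then have "h \<in> Hom T Z (ShO T 1 X)" using assms by (simp add: Hom_iff)
  then show ?thesis unfolding dist_triangle_def using assms by blast
qed

lemma dist_triangleE:
  assumes "dist_triangle T X Y Z"
  obtains f g h where "(f, g, h) \<in> Tri T" "f \<in> Hom T X Y" "g \<in> Hom T Y Z" "h \<in> Hom T Z (ShO T 1 X)"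
  using assms unfolding dist_triangle_def by blast

lemma dist_triangle_Ob:
  assumes "dist_triangle T X Y Z"
  shows "X \<in> Ob T" "Y \<in> Ob T" "Z \<in> Ob T"
  using assms Hom_Ob unfolding dist_triangle_def by blast+

lemma dist_triangle_rotate_back:
  assumes "dist_triangle T X Y Z"
  shows "dist_triangle T (ShO T (- 1) Z) X Y"
proof -
  obtain f g h where t: "(f, g, h) \<in> Tri T" "f \<in> Hom T X Y" "g \<in> Hom T Y Z" "h \<in> Hom T Z (ShO T 1 X)"
    using dist_triangleE[OF assms] .
  show ?thesis using dist_triangleI[OF rotate_back(1,2)[OF t] t(2)] .
qed

text \<open>Three backward rotations, passing through Z, X[1], Y and then Y[-1], Z, X[1]. Signs
  disappear because \<open>dist_triangle\<close> quantifies over the arrows.\<close>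

lemma dist_triangle_unshift:
  assumes "dist_triangle T (ShO T 1 X) Y (ShO T 1 Z)" "X \<in> Ob T" "Z \<in> Ob T"
  shows "dist_triangle T X (ShO T (- 1) Y) Z"
  using dist_triangle_rotate_back[OF dist_triangle_rotate_back[OF dist_triangle_rotate_back[OF assms(1)]]]
    ShO_cancel(2)[OF assms(2), of 1] ShO_cancel(2)[OF assms(3), of 1] by simp

lemma cone_Hom:
  assumes f: "f \<in> Hom T X Y"
  obtains g h Z where "(f, g, h) \<in> Tri T" "g \<in> Hom T Y Z" "h \<in> Hom T Z (ShO T 1 X)"
proof -
  obtain g h where t: "(f, g, h) \<in> Tri T" using TR1_cone[of f] f by (auto simp: Hom_iff)
  obtain X' Y' Z where *: "f \<in> Hom T X' Y'" "g \<in> Hom T Y' Z" "h \<in> Hom T Z (ShO T 1 X')"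
    using Tri_wf[OF t] by blast
  have "X' = X" "Y' = Y" using *(1) f by (simp_all add: Hom_iff)
  then show ?thesis using that[OF t] * by simp
qed

text \<open>The cone of -h[-1], rotated once; the two signs cancel, so the third arrow is
  \<open>h\<close> itself. This turns an element of Hom(A, B[1]) into an extension.\<close>

lemma cocone_Hom:
  assumes h: "h \<in> Hom T Z (ShO T 1 X)" and X: "X \<in> Ob T"
  obtains f g Y where "(f, g, h) \<in> Tri T" "f \<in> Hom T X Y" "g \<in> Hom T Y Z"
proof -
  have Z: "Z \<in> Ob T" using Hom_Ob(1)[OF h] .
  have h': "ShA T (- 1) h \<in> Hom T (ShO T (- 1) Z) X"
    using ShA_in_Hom[OF h, of "- 1"] ShO_cancel(2)[OF X] by simp
  note k = Neg_in_Hom[OF h']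
  obtain f g Y where t: "(NegM T (ShA T (- 1) h), f, g) \<in> Tri T" "f \<in> Hom T X Y"
      "g \<in> Hom T Y (ShO T 1 (ShO T (- 1) Z))"
    using cone_Hom[OF k] .
  have "NegM T (ShA T 1 (NegM T (ShA T (- 1) h))) = NegM T (NegM T (ShA T 1 (ShA T (- 1) h)))"
    using ShA_Neg[OF h', of 1] by simp
  also have "\<dots> = h"
    using ShA_cancel(1)[of h 1] Neg_Neg[OF h] h by (simp add: Hom_iff)
  finally have "(f, g, h) \<in> Tri T" using rotate(1)[OF t(1) k t(2,3)] by simp
  then show ?thesis using that t(2,3) ShO_cancel(1)[OF Z] by simp
qed

section \<open>Exactness of Hom on triangles\<close>

lemma TR3_Hom:
  assumes "(f, g, h) \<in> Tri T" "f \<in> Hom T X Y" "g \<in> Hom T Y Z"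
    and "(f', g', h') \<in> Tri T" "f' \<in> Hom T X' Y'" "g' \<in> Hom T Y' Z'"
    and "a \<in> Hom T X X'" "b \<in> Hom T Y Y'" "b \<star> f = f' \<star> a"
  obtains c where "c \<in> Hom T Z Z'" "c \<star> g = g' \<star> b" "ShA T 1 a \<star> h = h' \<star> c"
proof -
  have "Dom T f = X" "Dom T f' = X'" "Cod T f = Y" "Cod T f' = Y'" "Cod T g = Z" "Cod T g' = Z'"
    using assms by (simp_all add: Hom_iff)
  then show ?thesis using TR3[OF assms(1,4), of a b] assms(7-9) that by auto
qed

text \<open>\<open>TR3\<close>, applied to the triangle X = X -> N with the identity and
  \<open>f\<close>, factors \<open>g \<star> f\<close> through the zero object N.\<close>

lemma Tri_Comp:
  assumes "(f, g, h) \<in> Tri T" "f \<in> Hom T X Y" "g \<in> Hom T Y Z"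
  shows "g \<star> f = ZeroM T X Z"
proof -
  obtain N where N: "zero_obj T N" using zero_obj_exists by blast
  then have NO: "N \<in> Ob T" by (simp add: zero_obj_def)
  have O: "X \<in> Ob T" "Y \<in> Ob T" "Z \<in> Ob T" using assms Hom_Ob by blast+
  obtain c where c: "c \<in> Hom T N Z" "c \<star> ZeroM T X N = g \<star> f"
    using TR3_Hom[OF TR1_Ident[OF O(1) N] Ident_in_Hom[OF O(1)] Zero_in_Hom[OF O(1) NO] assms
        Ident_in_Hom[OF O(1)] assms(2)] by auto
  then show ?thesis using Comp_Zero_right[OF c(1) O(1)] by simp
qed

text \<open>Exactness of Hom(W, -) at the middle term. \<open>TR3\<close> fills in third arrows
  only, so both triangles are rotated once and the lift appears as c[-1].\<close>

lemma weak_kernel: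
  assumes t: "(f, g, h) \<in> Tri T" "f \<in> Hom T X Y" "g \<in> Hom T Y Z" "h \<in> Hom T Z (ShO T 1 X)"
    and w: "w \<in> Hom T W Y" and gw: "g \<star> w = ZeroM T W Z"
  obtains v where "v \<in> Hom T W X" "f \<star> v = w"
proof -
  obtain N where N: "zero_obj T N" using zero_obj_exists by blast
  then have NO: "N \<in> Ob T" by (simp add: zero_obj_def)
  have O: "X \<in> Ob T" "W \<in> Ob T" "Z \<in> Ob T" using w t Hom_Ob by blast+
  note W1 = ShO_in_Ob[OF O(2), of 1]
  note id = Ident_in_Hom[OF W1]
  have t': "(ZeroM T W N, ZeroM T N (ShO T 1 W), NegM T (Ident T (ShO T 1 W))) \<in> Tri T"
    using rotate(1)[OF TR1_Ident[OF O(2) N] Ident_in_Hom[OF O(2)] Zero_in_Hom[OF O(2) NO]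
        Zero_in_Hom[OF NO W1]] ShA_Ident[OF O(2)] by simp
  have sq: "ZeroM T N Z \<star> ZeroM T W N = g \<star> w"
    using gw Comp_Zero_left[OF Zero_in_Hom[OF O(2) NO] O(3)] by simp
  obtain c where c: "c \<in> Hom T (ShO T 1 W) (ShO T 1 X)"
    "ShA T 1 w \<star> NegM T (Ident T (ShO T 1 W)) = NegM T (ShA T 1 f) \<star> c"
    using TR3_Hom[OF t' Zero_in_Hom[OF O(2) NO] Zero_in_Hom[OF NO W1] rotate(1)[OF t] t(3,4) w
        Zero_in_Hom[OF NO O(3)] sq] by blast
  note f1 = ShA_in_Hom[OF t(2), of 1] and w1 = ShA_in_Hom[OF w, of 1]
  have "NegM T (ShA T 1 w) = NegM T (ShA T 1 f \<star> c)"
    using c(2) Comp_Neg_right[OF id w1] Comp_Ident_right[OF w1] Comp_Neg_left[OF c(1) f1] by simp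
  \<comment> \<open>Both triangles were rotated, so the sign occurs on both sides and
    cancels.\<close>
  then have wc: "ShA T 1 w = ShA T 1 f \<star> c"
    using arg_cong[of _ _ "NegM T"] Neg_Neg[OF w1] Neg_Neg[OF Comp_in_Hom[OF c(1) f1]] by metis
  have v: "ShA T (- 1) c \<in> Hom T W X"
    using ShA_in_Hom[OF c(1), of "- 1"] ShO_cancel(2)[OF O(1)] ShO_cancel(2)[OF O(2)] by simp
  have "ShA T 1 (f \<star> ShA T (- 1) c) = ShA T 1 w"
    using ShA_Comp[OF v t(2), of 1] ShA_cancel(1)[of c 1] c(1) wc by (simp add: Hom_iff)
  then have "f \<star> ShA T (- 1) c = w"
    using ShA_eq_iff Comp_in_Hom[OF v t(2)] w by (simp add: Hom_iff)
  with v show ?thesis using that by blast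
qed

text \<open>Exactness of Hom(-, W) at the middle term: \<open>TR3\<close> maps the given triangle to
  N -> W = W, whose third arrow is the required factorization.\<close>

lemma weak_cokernel:
  assumes t: "(f, g, h) \<in> Tri T" "f \<in> Hom T X Y" "g \<in> Hom T Y Z" "h \<in> Hom T Z (ShO T 1 X)"
    and w: "w \<in> Hom T Y W" and wf: "w \<star> f = ZeroM T X W"
  obtains v where "v \<in> Hom T Z W" "v \<star> g = w"
proof -
  obtain N where N: "zero_obj T N" using zero_obj_exists by blast
  then have NO: "N \<in> Ob T" by (simp add: zero_obj_def)
  have O: "X \<in> Ob T" "W \<in> Ob T" "Z \<in> Ob T" using w t Hom_Ob by blast+
  have "zero_obj T (ShO T 1 N)"
    using N ShA_Ident[OF NO, of 1] ShA_Zero[OF NO NO, of 1] ShO_in_Ob[OF NO]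
    by (simp add: zero_obj_iff)
  \<comment> \<open>The triangle N -> W = W arises by rotating W = W -> N[1] backwards; its zero
    arrow is its own negative.\<close>
  from TR1_Ident[OF O(2) this]
  have "(Ident T W, ZeroM T W (ShO T 1 N), NegM T (ShA T 1 (ZeroM T N W))) \<in> Tri T"
    using ShA_Zero[OF NO O(2), of 1] Neg_Zero[OF ShO_in_Ob[OF NO] ShO_in_Ob[OF O(2)]] by simp
  then have t': "(ZeroM T N W, Ident T W, ZeroM T W (ShO T 1 N)) \<in> Tri T"
    using TR2[OF Zero_in_Hom[OF NO O(2)] Ident_in_Hom[OF O(2)] Zero_in_Hom[OF O(2) ShO_in_Ob[OF NO]]]
    by simp
  have sq: "w \<star> f = ZeroM T N W \<star> ZeroM T X N"
    using wf Comp_Zero_left[OF Zero_in_Hom[OF O(1) NO] O(2)] by simp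
  obtain c where c: "c \<in> Hom T Z W" "c \<star> g = Ident T W \<star> w"
    using TR3_Hom[OF t(1-3) t' Zero_in_Hom[OF NO O(2)] Ident_in_Hom[OF O(2)]
        Zero_in_Hom[OF O(1) NO] w sq] by blast
  then show ?thesis using that Comp_Ident_left[OF w] by simp
qed

section \<open>The octahedral axiom and regrouping of extensions\<close>

lemma TR4_dist_triangle:
  assumes "f \<in> Hom T X Y" "g \<in> Hom T Y Z"
    and "(f, p\<^sub>1, d\<^sub>1) \<in> Tri T" "p\<^sub>1 \<in> Hom T Y A"
    and "(g \<star> f, p\<^sub>2, d\<^sub>2) \<in> Tri T" "p\<^sub>2 \<in> Hom T Z B"
    and "(g, p\<^sub>3, d\<^sub>3) \<in> Tri T" "p\<^sub>3 \<in> Hom T Z C"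
  shows "dist_triangle T A B C"
proof -
  have "Cod T p\<^sub>1 = A" "Cod T p\<^sub>2 = B" "Cod T p\<^sub>3 = C" using assms by (simp_all add: Hom_iff)
  then obtain a b where "a \<in> Hom T A B" "b \<in> Hom T B C" "(a, b, ShA T 1 p\<^sub>1 \<star> d\<^sub>3) \<in> Tri T"
    using TR4[OF assms(1-3,5,7)] by auto
  then show ?thesis using dist_triangleI by blast
qed

text \<open>\<open>Q\<close> is the cone of the composite X -> M -> E.\<close>

lemma dist_triangle_assoc:
  assumes "dist_triangle T X M Y" "dist_triangle T M E Z"
  obtains Q where "dist_triangle T Y Q Z" "dist_triangle T X E Q"
proof -
  obtain f p\<^sub>1 d\<^sub>1 where f: "(f, p\<^sub>1, d\<^sub>1) \<in> Tri T" "f \<in> Hom T X M" "p\<^sub>1 \<in> Hom T M Y"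
    using dist_triangleE[OF assms(1)] by blast
  obtain g p\<^sub>3 d\<^sub>3 where g: "(g, p\<^sub>3, d\<^sub>3) \<in> Tri T" "g \<in> Hom T M E" "p\<^sub>3 \<in> Hom T E Z"
    using dist_triangleE[OF assms(2)] by blast
  obtain p\<^sub>2 d\<^sub>2 Q where gf: "(g \<star> f, p\<^sub>2, d\<^sub>2) \<in> Tri T" "p\<^sub>2 \<in> Hom T E Q"
    using cone_Hom[OF Comp_in_Hom[OF f(2) g(2)]] by blast
  show ?thesis
    using that[OF TR4_dist_triangle[OF f(2) g(2) f(1,3) gf g(1,3)]
        dist_triangleI[OF gf(1) Comp_in_Hom[OF f(2) g(2)] gf(2)]] .
qed

text \<open>The octahedron is built on E -> Q -> Z. Its cones are X[1], R and Y[1], so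
  \<open>M\<close> is R[-1].\<close>

lemma dist_triangle_assoc_back:
  assumes "dist_triangle T X E Q" "dist_triangle T Y Q Z"
  obtains M where "dist_triangle T X M Y" "dist_triangle T M E Z"
proof -
  obtain f p d where f: "(f, p, d) \<in> Tri T" "f \<in> Hom T X E" "p \<in> Hom T E Q" "d \<in> Hom T Q (ShO T 1 X)"
    using dist_triangleE[OF assms(1)] .
  obtain g q e where g: "(g, q, e) \<in> Tri T" "g \<in> Hom T Y Q" "q \<in> Hom T Q Z" "e \<in> Hom T Z (ShO T 1 Y)"
    using dist_triangleE[OF assms(2)] .
  note qp = Comp_in_Hom[OF f(3) g(3)]
  obtain r c R where r: "(q \<star> p, r, c) \<in> Tri T" "r \<in> Hom T Z R"
    using cone_Hom[OF qp] by blast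
  have "dist_triangle T (ShO T 1 X) R (ShO T 1 Y)"
    using TR4_dist_triangle[OF f(3) g(3) rotate(1)[OF f] f(4) r rotate(1)[OF g] g(4)] .
  then have "dist_triangle T X (ShO T (- 1) R) Y"
    using dist_triangle_unshift[OF _ dist_triangle_Ob(1)[OF assms(1)] dist_triangle_Ob(1)[OF assms(2)]]
    by blast
  moreover have "dist_triangle T (ShO T (- 1) R) E Z"
    using dist_triangle_rotate_back[OF dist_triangleI[OF r(1) qp r(2)]] .
  ultimately show ?thesis using that by blast
qed

lemma dist_triangle_Ident:
  "X \<in> Ob T \<Longrightarrow> zero_obj T N \<Longrightarrow> dist_triangle T X X N"
  using dist_triangleI[OF TR1_Ident Ident_in_Hom Zero_in_Hom] by (simp add: zero_obj_def)

lemma zero_obj_ShO: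
  assumes "zero_obj T N"
  shows "zero_obj T (ShO T n N)"
proof -
  have "N \<in> Ob T" "Ident T N = ZeroM T N N" using assms by (simp_all add: zero_obj_iff)
  then show ?thesis
    using ShA_Ident[of N n] ShA_Zero[of N N n] ShO_in_Ob[of N n] unfolding zero_obj_iff by metis
qed

lemma dist_triangle_Ident_right:
  assumes "X \<in> Ob T" "zero_obj T N"
  shows "dist_triangle T N X X"
proof -
  have "N \<in> Ob T" using assms(2) by (simp add: zero_obj_def)
  then show ?thesis
    using dist_triangle_rotate_back[OF dist_triangle_Ident[OF assms(1) zero_obj_ShO[OF assms(2), of 1]]]
      ShO_cancel(2)[of N 1] by simp
qed

text \<open>The connecting arrow of the first triangle vanishes; completing a section of \<open>E \<rightarrow> B\<close> to a
  triangle exchanges the two outer terms, up to the isomorphism \<open>A \<rightarrow> C\<close> encoded by the triangle with third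
  term \<open>N\<close>.\<close>

lemma dist_triangle_swap:
  assumes "dist_triangle T A E B" "Hom_zero T B (ShO T 1 A)" "zero_obj T N"
  obtains C where "dist_triangle T B E C" "dist_triangle T A C N"
proof -
  obtain f g h where t: "(f, g, h) \<in> Tri T" "f \<in> Hom T A E" "g \<in> Hom T E B" "h \<in> Hom T B (ShO T 1 A)"
    using dist_triangleE[OF assms(1)] .
  have O: "A \<in> Ob T" "B \<in> Ob T" "N \<in> Ob T"
    using dist_triangle_Ob[OF assms(1)] assms(3) by (simp_all add: zero_obj_def)
  note id = Ident_in_Hom[OF O(2)]
  have "h \<star> Ident T B = ZeroM T B (ShO T 1 A)"
    using Hom_zeroD[OF assms(2) t(4)] Comp_Ident_right[OF t(4)] by simp
  then obtain s where s: "s \<in> Hom T B E" "g \<star> s = Ident T B"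
    using weak_kernel[OF rotate(1)[OF t] t(3,4) rotate(2)[OF t] id] by blast
  obtain p d C where p: "(s, p, d) \<in> Tri T" "p \<in> Hom T E C"
    using cone_Hom[OF s(1)] by blast
  \<comment> \<open>The composite is the identity with cone \<open>N\<close>, so the octahedron
    relates the cones C, N and A[1].\<close>
  have gs: "(g \<star> s, ZeroM T B N, ZeroM T N (ShO T 1 B)) \<in> Tri T"
    using TR1_Ident[OF O(2) assms(3)] s(2) by simp
  have C: "dist_triangle T C N (ShO T 1 A)"
    using TR4_dist_triangle[OF s(1) t(3) p gs Zero_in_Hom[OF O(2,3)] rotate(1)[OF t] t(4)] .
  have "dist_triangle T A C N"
    using dist_triangle_rotate_back[OF C] ShO_cancel(2)[OF O(1), of 1] by simp
  then show ?thesis using that dist_triangleI[OF p(1) s(1) p(2)] by blast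
qed

lemma Hom_zero_dist_left:
  assumes "dist_triangle T X Y Z" "Hom_zero T X W" "Hom_zero T Z W" "W \<in> Ob T"
  shows "Hom_zero T Y W"
  unfolding Hom_zero_def
proof
  fix w assume w: "w \<in> Hom T Y W"
  obtain f g h where t: "(f, g, h) \<in> Tri T" "f \<in> Hom T X Y" "g \<in> Hom T Y Z" "h \<in> Hom T Z (ShO T 1 X)"
    using dist_triangleE[OF assms(1)] .
  obtain v where v: "v \<in> Hom T Z W" "v \<star> g = w"
    using weak_cokernel[OF t w Hom_zeroD[OF assms(2) Comp_in_Hom[OF t(2) w]]] .
  then show "w = ZeroM T Y W"
    using Hom_zeroD[OF assms(3) v(1)] Comp_Zero_left[OF t(3) assms(4)] by simp
qed

lemma Hom_zero_dist_right:
  assumes "dist_triangle T X Y Z" "Hom_zero T W X" "Hom_zero T W Z" "W \<in> Ob T"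
  shows "Hom_zero T W Y"
  unfolding Hom_zero_def
proof
  fix w assume w: "w \<in> Hom T W Y"
  obtain f g h where t: "(f, g, h) \<in> Tri T" "f \<in> Hom T X Y" "g \<in> Hom T Y Z" "h \<in> Hom T Z (ShO T 1 X)"
    using dist_triangleE[OF assms(1)] .
  obtain v where v: "v \<in> Hom T W X" "f \<star> v = w"
    using weak_kernel[OF t w Hom_zeroD[OF assms(3) Comp_in_Hom[OF w t(3)]]] .
  then show "w = ZeroM T W Y"
    using Hom_zeroD[OF assms(2) v(1)] Comp_Zero_right[OF t(2) assms(4)] by simp
qed

section \<open>Vanishing and decompositions in extension closures\<close>

lemma ext_closure_Ob:
  assumes "S \<subseteq> Ob T"
  shows "ext_closure T S \<subseteq> Ob T"
proof
  fix X assume "X \<in> ext_closure T S"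
  then show "X \<in> Ob T"
    by induction (use assms dist_triangle_Ob(2) in blast)+
qed

lemma ext_closure_minimal:
  assumes "S \<subseteq> C" "\<And>X Y Z. X \<in> C \<Longrightarrow> Z \<in> C \<Longrightarrow> dist_triangle T X Y Z \<Longrightarrow> Y \<in> C"
  shows "ext_closure T S \<subseteq> C"
proof
  fix X assume "X \<in> ext_closure T S"
  then show "X \<in> C"
    by induction (use assms in blast)+
qed

text \<open>Two inductions: over the closure of \<open>S'\<close> against a single generator in
  \<open>S\<close>, then over the closure of \<open>S\<close> against a fixed Y.\<close>

lemma ext_closure_Hom_zero:
  assumes "\<And>X Y. X \<in> S \<Longrightarrow> Y \<in> S' \<Longrightarrow> Hom_zero T X (ShO T n Y)"
    and S: "S \<subseteq> Ob T" and S': "S' \<subseteq> Ob T"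
    and X: "X \<in> ext_closure T S" and Y: "Y \<in> ext_closure T S'"
  shows "Hom_zero T X (ShO T n Y)"
proof -
  \<comment> \<open>With the shift moved to X, the triangles met in the induction on Y can be used
    unshifted.\<close>
  have right: "Hom_zero T (ShO T (- n) X) Y" if X: "X \<in> S" for X
    using Y
  proof induction
    case (incl Y)
    then show ?case
      using Hom_zero_ShO_left[OF subsetD[OF S X] subsetD[OF S' incl], of "- n"] assms(1)[OF X incl]
      by simp
  next
    case (ext Y\<^sub>1 Y\<^sub>2 Y)
    then show ?case
      using Hom_zero_dist_right[OF ext.hyps(3) ext.IH ShO_in_Ob[OF subsetD[OF S X]]] by simp
  qed
  have YO: "Y \<in> Ob T" using Y ext_closure_Ob[OF S'] by blast
  show ?thesis
    using X
  proof induction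
    case (incl X)
    then show ?case
      using Hom_zero_ShO_left[OF subsetD[OF S incl] YO, of "- n"] right[OF incl] by simp
  next
    case (ext X\<^sub>1 X\<^sub>2 X)
    then show ?case
      using Hom_zero_dist_left[OF ext.hyps(3) ext.IH(1,2) ShO_in_Ob[OF YO]] by simp
  qed
qed

text \<open>Writing \<open>X * Y\<close> for the class of extensions of \<open>Y\<close> by \<open>X\<close>, the inductive step is
  \<open>(B * A) * (B * A) = B * (A * B) * A \<subseteq> B * (B * A) * A \<subseteq> B * A\<close>.\<close>

lemma ext_closure_decomposition:
  assumes A: "\<A> \<subseteq> Ob T" "\<And>X Y Z. X \<in> \<A> \<Longrightarrow> Z \<in> \<A> \<Longrightarrow> dist_triangle T X Y Z \<Longrightarrow> Y \<in> \<A>"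
    and B: "\<B> \<subseteq> Ob T" "\<And>X Y Z. X \<in> \<B> \<Longrightarrow> Z \<in> \<B> \<Longrightarrow> dist_triangle T X Y Z \<Longrightarrow> Y \<in> \<B>"
    and N: "zero_obj T N" "N \<in> \<A>" "N \<in> \<B>"
    and BA: "\<And>B A. B \<in> \<B> \<Longrightarrow> A \<in> \<A> \<Longrightarrow> Hom_zero T B (ShO T 1 A)"
    and E: "E \<in> ext_closure T (\<A> \<union> \<B>)"
  shows "\<exists>B \<in> \<B>. \<exists>A \<in> \<A>. dist_triangle T B E A"
  using E
proof induction
  case (incl X)
  then show ?case
    using dist_triangle_Ident[of X N] dist_triangle_Ident_right[of X N] A(1) B(1) N by blast
next
  case (ext E\<^sub>1 E\<^sub>2 E)
  obtain B\<^sub>1 A\<^sub>1 B\<^sub>2 A\<^sub>2 where AB: "B\<^sub>1 \<in> \<B>" "A\<^sub>1 \<in> \<A>" "B\<^sub>2 \<in> \<B>" "A\<^sub>2 \<in> \<A>"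
    and t1: "dist_triangle T B\<^sub>1 E\<^sub>1 A\<^sub>1" and t2: "dist_triangle T B\<^sub>2 E\<^sub>2 A\<^sub>2"
    using ext.IH by blast
  obtain Q where Q: "dist_triangle T A\<^sub>1 Q E\<^sub>2" "dist_triangle T B\<^sub>1 E Q"
    using dist_triangle_assoc[OF t1 ext.hyps(3)] .
  obtain M where M: "dist_triangle T A\<^sub>1 M B\<^sub>2" "dist_triangle T M Q A\<^sub>2"
    using dist_triangle_assoc_back[OF Q(1) t2] .
  obtain C where C: "dist_triangle T B\<^sub>2 M C" "dist_triangle T A\<^sub>1 C N"
    using dist_triangle_swap[OF M(1) BA[OF AB(3,2)] N(1)] .
  obtain Q' where Q': "dist_triangle T C Q' A\<^sub>2" "dist_triangle T B\<^sub>2 Q Q'"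
    using dist_triangle_assoc[OF C(1) M(2)] .
  obtain M' where M': "dist_triangle T B\<^sub>1 M' B\<^sub>2" "dist_triangle T M' E Q'"
    using dist_triangle_assoc_back[OF Q(2) Q'(2)] .
  \<comment> \<open>\<open>C\<close> is isomorphic to \<open>A\<^sub>1\<close>, but membership comes
    from closure under extensions: it is an extension of \<open>N\<close> by
    \<open>A\<^sub>1\<close>.\<close>
  have "Q' \<in> \<A>" using A(2)[OF A(2)[OF AB(2) N(2) C(2)] AB(4) Q'(1)] .
  moreover have "M' \<in> \<B>" using B(2)[OF AB(1,3) M'(1)] .
  ultimately show ?case using M'(2) by blast
qed

lemma ext_closure_mono:
  assumes "S \<subseteq> S'"
  shows "ext_closure T S \<subseteq> ext_closure T S'"
proof (rule ext_closure_minimal)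
  show "S \<subseteq> ext_closure T S'" using assms by (auto intro: ext_closure.incl)
qed (rule ext_closure.ext)

section \<open>From triangles to short exact sequences\<close>

text \<open>The difference x - y is killed by \<open>f\<close>, so it factors through Z[-1] -> X,
  and W has only the zero arrow to Z[-1].\<close>

lemma Tri_mono:
  assumes t: "(f, g, h) \<in> Tri T" "f \<in> Hom T X Y" "g \<in> Hom T Y Z" "h \<in> Hom T Z (ShO T 1 X)"
    and "Hom_zero T W (ShO T (- 1) Z)"
    and x: "x \<in> Hom T W X" and y: "y \<in> Hom T W X" and "f \<star> x = f \<star> y"
  shows "x = y"
proof -
  note ny = Neg_in_Hom[OF y]
  let ?d = "AddM T x (NegM T y)"
  have d: "?d \<in> Hom T W X" using Add_in_Hom[OF x ny] .
  have W: "W \<in> Ob T" using Hom_Ob(1)[OF x] .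
  have "f \<star> ?d = ZeroM T W Y"
    using Comp_AddM_right[OF x ny t(2)] Comp_Neg_right[OF y t(2)] assms(8)
      Add_Neg_right[OF Comp_in_Hom[OF y t(2)]] by simp
  then obtain v where v: "v \<in> Hom T W (ShO T (- 1) Z)" "NegM T (ShA T (- 1) h) \<star> v = ?d"
    using weak_kernel[OF rotate_back(1,2)[OF t] t(2) rotate_back(3)[OF t] d] by blast
  then have "?d = ZeroM T W X"
    using Hom_zeroD[OF assms(5) v(1)] Comp_Zero_right[OF rotate_back(2)[OF t] W] by simp
  then show ?thesis using eq_if_diff_Zero[OF x y] by simp
qed

lemma Tri_epi:
  assumes t: "(f, g, h) \<in> Tri T" "f \<in> Hom T X Y" "g \<in> Hom T Y Z" "h \<in> Hom T Z (ShO T 1 X)"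
    and "Hom_zero T (ShO T 1 X) W"
    and x: "x \<in> Hom T Z W" and y: "y \<in> Hom T Z W" and "x \<star> g = y \<star> g"
  shows "x = y"
proof -
  note ny = Neg_in_Hom[OF y]
  let ?d = "AddM T x (NegM T y)"
  have d: "?d \<in> Hom T Z W" using Add_in_Hom[OF x ny] .
  have W: "W \<in> Ob T" using Hom_Ob(2)[OF x] .
  have "?d \<star> g = ZeroM T Y W"
    using Comp_AddM_left[OF t(3) x ny] Comp_Neg_left[OF t(3) y] assms(8)
      Add_Neg_right[OF Comp_in_Hom[OF t(3) y]] by simp
  then obtain v where v: "v \<in> Hom T (ShO T 1 X) W" "v \<star> h = ?d"
    using weak_cokernel[OF rotate(1)[OF t] t(3,4) rotate(2)[OF t] d] by blast
  then have "?d = ZeroM T Z W"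
    using Hom_zeroD[OF assms(5) v(1)] Comp_Zero_left[OF t(4) W] by simp
  then show ?thesis using eq_if_diff_Zero[OF x y] by simp
qed

text \<open>Existence of factorizations holds in every triangle; uniqueness is where the vanishing
  in degree -1 enters, once for W against A[-1] and once for B[1] against W.\<close>

lemma short_exact_full_sub:
  assumes t: "(i, j, h) \<in> Tri T" "i \<in> Hom T B E" "j \<in> Hom T E A" "h \<in> Hom T A (ShO T 1 B)"
    and G: "G \<subseteq> Ob T" "B \<in> G" "E \<in> G" "A \<in> G"
    and neg: "\<And>X Y. X \<in> G \<Longrightarrow> Y \<in> G \<Longrightarrow> Hom_zero T X (ShO T (- 1) Y)"
  shows "short_exact (full_sub T G) i j"
proof -
  interpret sub: preadditive_category "full_sub T G" by (rule preadditive_full_sub[OF G(1)])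
  have ij: "i \<in> Hom (full_sub T G) B E" "j \<in> Hom (full_sub T G) E A"
    using t G by (simp_all add: Hom_full_sub)
  have ji: "j \<star> i = ZeroM T B A" using Tri_Comp[OF t(1-3)] .
  have "\<exists>!v. v \<in> Hom T W B \<and> i \<star> v = w"
    if W: "W \<in> G" and w: "w \<in> Hom T W E" "j \<star> w = ZeroM T W A" for W w
  proof -
    obtain v where "v \<in> Hom T W B" "i \<star> v = w" using weak_kernel[OF t w] .
    then show ?thesis
      using Tri_mono[OF t neg[OF W G(4)]] by (intro ex1I[of _ v]) auto
  qed
  moreover have "\<exists>!v. v \<in> Hom T A W \<and> v \<star> j = w"
    if W: "W \<in> G" and w: "w \<in> Hom T E W" "w \<star> i = ZeroM T B W" for W w
  proof -
    have "Hom_zero T (ShO T 1 B) W"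
      using neg[OF G(2) W] Hom_zero_ShO_left[OF subsetD[OF G(1,2)] subsetD[OF G(1) W], of 1] by simp
    note epi = Tri_epi[OF t this]
    obtain v where "v \<in> Hom T A W" "v \<star> j = w" using weak_cokernel[OF t w] .
    then show ?thesis using epi by (intro ex1I[of _ v]) auto
  qed
  ultimately show ?thesis
    unfolding short_exact_def sub.is_kernel_iff[OF ij] sub.is_cokernel_iff[OF ij]
    using ji G by (simp add: Hom_full_sub)
qed

text \<open>No t-structure is needed for the backward direction: comparing a short exact sequence
  \<open>B \<rightarrow> E \<rightarrow> A\<close> of \<open>G\<close> with a triangle \<open>B' \<rightarrow> E \<rightarrow> A'\<close> through the (co)kernel properties and
  \<open>Hom(\<B>, \<A>) = 0\<close> makes \<open>B'\<close> a retract of \<open>B\<close> and \<open>A\<close> a retract of \<open>A'\<close>.\<close>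

lemma Ext1_full_sub_zero_iff:
  assumes G: "G \<subseteq> Ob T" "\<And>X Y Z. X \<in> G \<Longrightarrow> Z \<in> G \<Longrightarrow> dist_triangle T X Y Z \<Longrightarrow> Y \<in> G"
    and neg: "\<And>X Y. X \<in> G \<Longrightarrow> Y \<in> G \<Longrightarrow> Hom_zero T X (ShO T (- 1) Y)"
    and AB: "\<A> \<subseteq> G" "\<B> \<subseteq> G" "\<And>B A. B \<in> \<B> \<Longrightarrow> A \<in> \<A> \<Longrightarrow> Hom_zero T B A"
    and dec: "\<And>E. E \<in> G \<Longrightarrow> \<exists>B \<in> \<B>. \<exists>A \<in> \<A>. dist_triangle T B E A"
    and A: "A \<in> \<A>" and B: "B \<in> \<B>"
  shows "Ext1 (full_sub T G) A B = {Ext1_zero (full_sub T G) A B} \<longleftrightarrow> Hom_zero T A (ShO T 1 B)"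
proof -
  interpret sub: preadditive_category "full_sub T G" by (rule preadditive_full_sub[OF G(1)])
  have AG: "A \<in> G" and BG: "B \<in> G" using A B AB by auto
  have AO: "A \<in> Ob T" and BO: "B \<in> Ob T" using AG BG G(1) by auto
  have ext: "\<exists>i j E. (i, j) \<in> extensions (full_sub T G) A B \<and> (i, j, h) \<in> Tri T \<and>
      i \<in> Hom T B E \<and> j \<in> Hom T E A" if h: "h \<in> Hom T A (ShO T 1 B)" for h
  proof -
    obtain i j E where t: "(i, j, h) \<in> Tri T" "i \<in> Hom T B E" "j \<in> Hom T E A"
      using cocone_Hom[OF h BO] .
    have "E \<in> G" using G(2)[OF BG AG dist_triangleI[OF t]] .
    then have "short_exact (full_sub T G) i j"
      using short_exact_full_sub[OF t h G(1) BG _ AG neg] by blast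
    then have "(i, j) \<in> extensions (full_sub T G) A B"
      using t(2,3) by (simp add: extensions_def Hom_iff)
    then show ?thesis using t by blast
  qed
  \<comment> \<open>The zero arrow A -> B[1] already provides an extension.\<close>
  have ne: "extensions (full_sub T G) A B \<noteq> {}"
    using ext[OF Zero_in_Hom[OF AO ShO_in_Ob[OF BO]]] by blast
  show ?thesis
    unfolding sub.Ext1_eq_zero_iff[OF ne]
  proof
    assume split: "\<forall>(i, j) \<in> extensions (full_sub T G) A B.
      \<exists>s \<in> Hom (full_sub T G) A (Dom (full_sub T G) j).
        j \<star>\<^bsub>full_sub T G\<^esub> s = Ident (full_sub T G) A"
    show "Hom_zero T A (ShO T 1 B)"
      unfolding Hom_zero_def
    proof
      fix h assume h: "h \<in> Hom T A (ShO T 1 B)"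
      obtain i j E where ij: "(i, j) \<in> extensions (full_sub T G) A B" "(i, j, h) \<in> Tri T"
        "i \<in> Hom T B E" "j \<in> Hom T E A"
        using ext[OF h] by blast
      have Dj: "Dom T j = E" using ij(4) by (simp add: Hom_iff)
      obtain s where "s \<in> Hom (full_sub T G) A E" "j \<star> s = Ident T A"
        using split ij(1) Dj by auto
      then have s: "s \<in> Hom T A E" "j \<star> s = Ident T A" by (auto dest: Hom_full_subD)
      \<comment> \<open>A section \<open>s\<close> of \<open>j\<close> gives h = h j s, and
        consecutive arrows of a triangle compose to zero.\<close>
      have "h = (h \<star> j) \<star> s"
        using Comp_assoc[OF s(1) ij(4) h] s(2) Comp_Ident_right[OF h] by simp
      also have "h \<star> j = ZeroM T E (ShO T 1 B)"
        using Tri_Comp[OF rotate(1)[OF ij(2-4) h] ij(4) h] .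
      finally show "h = ZeroM T A (ShO T 1 B)"
        using Comp_Zero_left[OF s(1) ShO_in_Ob[OF BO]] by simp
    qed
  next
    assume h0: "Hom_zero T A (ShO T 1 B)"
    have "\<exists>s \<in> Hom (full_sub T G) A (Dom T j). j \<star> s = Ident T A"
      if ij: "(i, j) \<in> extensions (full_sub T G) A B" for i j
    proof -
      define E where "E = Dom T j"
      have ker: "is_kernel (full_sub T G) i j" and cok: "is_cokernel (full_sub T G) j i"
        and DC: "Dom T i = B" "Cod T j = A"
        using ij by (simp_all add: extensions_def short_exact_def)
      have iG: "i \<in> Hom (full_sub T G) B E" and jG: "j \<in> Hom (full_sub T G) E A"
        using ker DC by (simp_all add: is_kernel_def Hom_iff E_def)
      have i: "i \<in> Hom T B E" and j: "j \<in> Hom T E A" and EG: "E \<in> G"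
        using Hom_full_subD[OF iG] Hom_full_subD[OF jG] by auto
      obtain B' A' where BA': "B' \<in> \<B>" "A' \<in> \<A>" "dist_triangle T B' E A'"
        using dec[OF EG] by blast
      obtain f g h where t: "(f, g, h) \<in> Tri T" "f \<in> Hom T B' E" "g \<in> Hom T E A'"
        "h \<in> Hom T A' (ShO T 1 B')"
        using dist_triangleE[OF BA'(3)] .
      have BAG: "B' \<in> G" "A' \<in> G" using BA' AB by auto
      note BO' = subsetD[OF G(1) BAG(1)]
      have fG: "f \<in> Hom (full_sub T G) B' E" and gG: "g \<in> Hom (full_sub T G) E A'"
        using t BAG EG by (simp_all add: Hom_full_sub)
      \<comment> \<open>Semiorthogonality makes each of the two sequences factor through the other,
        on the left by \<open>u\<close>, \<open>v\<close> and on the right by \<open>c\<close>,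
        \<open>d\<close>.\<close>
      have gi: "g \<star> i = ZeroM T B A'" and jf: "j \<star> f = ZeroM T B' A"
        using Hom_zeroD[OF AB(3)[OF B BA'(2)] Comp_in_Hom[OF i t(3)]]
          Hom_zeroD[OF AB(3)[OF BA'(1) A] Comp_in_Hom[OF t(2) j]] by auto
      obtain u where u: "u \<in> Hom T B B'" "f \<star> u = i" using weak_kernel[OF t i gi] .
      obtain v where "v \<in> Hom (full_sub T G) B' B" "i \<star> v = f"
        using sub.kernel_lift[OF ker iG jG fG] jf by auto
      then have v: "v \<in> Hom T B' B" "i \<star> v = f" by (auto dest: Hom_full_subD)
      have "f \<star> (u \<star> v) = f \<star> Ident T B'"
        using Comp_assoc[OF v(1) u(1) t(2)] u(2) v(2) Comp_Ident_right[OF t(2)] by simp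
      then have uv: "u \<star> v = Ident T B'"
        using Tri_mono[OF t neg[OF BAG] Comp_in_Hom[OF v(1) u(1)] Ident_in_Hom[OF BO']] by simp
      \<comment> \<open>B'[1] is a retract of B[1], so the hypothesis on Hom(A, B[1]) carries over
        to it.\<close>
      have "ShA T 1 u \<star> ShA T 1 v = Ident T (ShO T 1 B')"
        using ShA_Comp[OF v(1) u(1), of 1] ShA_Ident[OF BO', of 1] uv by simp
      then have h0': "Hom_zero T A (ShO T 1 B')"
        using Hom_zero_split[OF ShA_in_Hom[OF u(1)] ShA_in_Hom[OF v(1)] _ h0 AO] by simp
      obtain d where d: "d \<in> Hom T A' A" "d \<star> g = j" using weak_cokernel[OF t j jf] .
      obtain c where "c \<in> Hom (full_sub T G) A A'" "c \<star> j = g"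
        using sub.cokernel_lift[OF cok iG jG gG] gi by auto
      then have c: "c \<in> Hom T A A'" "c \<star> j = g" by (auto dest: Hom_full_subD)
      note dcH = Comp_in_Hom[OF c(1) d(1)]
      have "(d \<star> c) \<star> j = Ident T A \<star> j"
        using Comp_assoc[OF j c(1) d(1)] c(2) d(2) Comp_Ident_left[OF j] by simp
      then have dc: "d \<star> c = Ident T A"
        using sub.cokernel_epi[OF cok iG jG, of "d \<star> c" A "Ident T A"] dcH Ident_in_Hom[OF AO] AG
        by (simp add: Hom_full_sub)
      \<comment> \<open>The obstruction to lifting \<open>c\<close> along \<open>g\<close> vanishes.
        The lift \<open>s\<close> splits \<open>j\<close>, since j s = d g s = d c.\<close>
      have "h \<star> c = ZeroM T A (ShO T 1 B')"
        using Hom_zeroD[OF h0' Comp_in_Hom[OF c(1) t(4)]] .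
      then obtain s where s: "s \<in> Hom T A E" "g \<star> s = c"
        using weak_kernel[OF rotate(1)[OF t] t(3,4) rotate(2)[OF t] c(1)] by blast
      have "j \<star> s = Ident T A"
        using Comp_assoc[OF s(1) t(3) d(1)] d(2) s(2) dc by simp
      then show ?thesis using s(1) AG EG by (auto simp: Hom_full_sub E_def)
    qed
    then show "\<forall>(i, j) \<in> extensions (full_sub T G) A B.
      \<exists>s \<in> Hom (full_sub T G) A (Dom (full_sub T G) j).
        j \<star>\<^bsub>full_sub T G\<^esub> s = Ident (full_sub T G) A"
      by auto
  qed
qed

text \<open>No closure under extensions in \<open>T\<close> is assumed of
  \<open>\<A>\<^sub>0\<close> and \<open>\<B>\<^sub>0\<close>. Inside \<open>gl\<close> they are
  replaced by larger, mutually orthogonal classes that have it.\<close>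

lemma Ext1_gl_zero_iff:
  assumes Ob: "\<A>\<^sub>0 \<subseteq> Ob T" "\<B>\<^sub>0 \<subseteq> Ob T" and N: "zero_obj T N" "N \<in> \<A>\<^sub>0"
    and orth: "\<And>B A n. B \<in> \<B>\<^sub>0 \<Longrightarrow> A \<in> \<A>\<^sub>0 \<Longrightarrow> Hom_zero T (ShO T n B) A"
    and neg: "\<And>X Y. X \<in> \<A>\<^sub>0 \<union> \<B>\<^sub>0 \<Longrightarrow> Y \<in> \<A>\<^sub>0 \<union> \<B>\<^sub>0 \<Longrightarrow> Hom_zero T X (ShO T (- 1) Y)"
    and A: "A \<in> \<A>\<^sub>0" and B: "B \<in> \<B>\<^sub>0"
  shows "Ext1 (full_sub T (gl T \<A>\<^sub>0 \<B>\<^sub>0)) A B = {Ext1_zero (full_sub T (gl T \<A>\<^sub>0 \<B>\<^sub>0)) A B}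
    \<longleftrightarrow> Hom_zero T A (ShO T 1 B)"
proof -
  define G where "G = gl T \<A>\<^sub>0 \<B>\<^sub>0"
  have AB0: "\<A>\<^sub>0 \<union> \<B>\<^sub>0 \<subseteq> Ob T" using Ob by blast
  have G: "G \<subseteq> Ob T" "\<A>\<^sub>0 \<subseteq> G" "\<B>\<^sub>0 \<subseteq> G"
    using ext_closure_Ob[OF AB0] by (auto simp: G_def gl_def intro: ext_closure.incl)
  have G_ext: "Y \<in> G" if "X \<in> G" "Z \<in> G" "dist_triangle T X Y Z" for X Y Z
    using that unfolding G_def gl_def by (rule ext_closure.ext)
  \<comment> \<open>All shifts are included because degree 1 is used to decompose objects of
    \<open>G\<close> and degree 0 to compare sequences. Defining \<open>\<B>'\<close> against
    \<open>\<A>'\<close> rather than \<open>\<A>\<^sub>0\<close> makes the two classes orthogonal by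
    construction.\<close>
  define \<A>' where "\<A>' = {X \<in> G. \<forall>B \<in> \<B>\<^sub>0. \<forall>n. Hom_zero T (ShO T n B) X}"
  define \<B>' where "\<B>' = {X \<in> G. \<forall>Y \<in> \<A>'. \<forall>n. Hom_zero T X (ShO T n Y)}"
  have sub: "\<A>' \<subseteq> G" "\<B>' \<subseteq> G" by (auto simp: \<A>'_def \<B>'_def)
  have A0: "\<A>\<^sub>0 \<subseteq> \<A>'" using orth G by (auto simp: \<A>'_def)
  have B0: "\<B>\<^sub>0 \<subseteq> \<B>'"
  proof
    fix X assume X: "X \<in> \<B>\<^sub>0"
    have "Hom_zero T X (ShO T n Y)" if Y: "Y \<in> \<A>'" for Y n
    proof -
      have "Hom_zero T (ShO T (- n) X) Y" using Y X by (simp add: \<A>'_def)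
      moreover have "X \<in> Ob T" "Y \<in> Ob T" using X Y G(1) sub(1) Ob(2) by auto
      ultimately show ?thesis using Hom_zero_ShO_left[of X Y "- n"] by simp
    qed
    then show "X \<in> \<B>'" using X G(3) by (auto simp: \<B>'_def)
  qed
  have A_ext: "Y \<in> \<A>'" if X: "X \<in> \<A>'" and Z: "Z \<in> \<A>'" and t: "dist_triangle T X Y Z" for X Y Z
  proof -
    have "Hom_zero T (ShO T n B) Y" if B: "B \<in> \<B>\<^sub>0" for B n
      using Hom_zero_dist_right[OF t _ _ ShO_in_Ob[OF subsetD[OF Ob(2) B]]] X Z B
      by (simp add: \<A>'_def)
    then show ?thesis using G_ext[OF _ _ t] X Z by (simp add: \<A>'_def)
  qed
  have B_ext: "Y \<in> \<B>'" if X: "X \<in> \<B>'" and Z: "Z \<in> \<B>'" and t: "dist_triangle T X Y Z" for X Y Z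
  proof -
    have "Hom_zero T Y (ShO T n W)" if W: "W \<in> \<A>'" for W n
      using Hom_zero_dist_left[OF t _ _ ShO_in_Ob[OF subsetD[OF G(1) subsetD[OF sub(1) W]]]] X Z W
      by (simp add: \<B>'_def)
    then show ?thesis using G_ext[OF _ _ t] X Z by (simp add: \<B>'_def)
  qed
  have NA: "N \<in> \<A>'" using N(2) A0 by blast
  have NB: "N \<in> \<B>'"
  proof -
    have "Hom_zero T N (ShO T n Y)" if "Y \<in> \<A>'" for Y n
      using Hom_zero_Ident_left[of N "ShO T n Y"] N(1) unfolding zero_obj_iff by auto
    then show ?thesis using N(2) G(2) by (auto simp: \<B>'_def)
  qed
  have BA: "Hom_zero T B (ShO T n A)" if "B \<in> \<B>'" "A \<in> \<A>'" for A B n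
    using that by (simp add: \<B>'_def)
  have BA0: "Hom_zero T B A" if BA': "B \<in> \<B>'" "A \<in> \<A>'" for A B
    using BA[OF that, of 0] ShO_0[of A] that(2) sub(1) G(1) by auto
  have G': "G \<subseteq> ext_closure T (\<A>' \<union> \<B>')"
    unfolding G_def gl_def using ext_closure_mono[OF Un_mono[OF A0 B0]] .
  have dec: "\<exists>B \<in> \<B>'. \<exists>A \<in> \<A>'. dist_triangle T B E A" if "E \<in> G" for E
    using ext_closure_decomposition[OF subset_trans[OF sub(1) G(1)] A_ext
        subset_trans[OF sub(2) G(1)] B_ext N(1) NA NB BA subsetD[OF G' that]] .
  have neg': "Hom_zero T X (ShO T (- 1) Y)" if "X \<in> G" "Y \<in> G" for X Y
    using ext_closure_Hom_zero[OF neg AB0 AB0] that by (simp add: G_def gl_def)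
  have "A \<in> \<A>'" "B \<in> \<B>'" using A B A0 B0 by auto
  then show ?thesis
    using Ext1_full_sub_zero_iff[OF G(1) G_ext neg' sub BA0 dec] by (simp add: G_def)
qed

end

section \<open>Triangles in full triangulated subcategories\<close>

lemma Hom_tri_sub: "Hom (tri_sub T S) X Y = (if X \<in> S \<and> Y \<in> S then Hom T X Y else {})"
  by (auto simp: tri_sub_def full_sub_def Hom_def)

lemma tri_sub_simps [simp]:
  "Ob (tri_sub T S) = S" "ShO (tri_sub T S) = ShO T" "ZeroM (tri_sub T S) = ZeroM T"
  "Ident (tri_sub T S) = Ident T"
  by (simp_all add: tri_sub_def full_sub_def)

lemma dist_triangle_tri_sub:
  assumes "dist_triangle (tri_sub T S) X Y Z"
  shows "dist_triangle T X Y Z" "Y \<in> S"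
proof -
  obtain f g h where "(f, g, h) \<in> Tri (tri_sub T S)" "f \<in> Hom (tri_sub T S) X Y"
    "g \<in> Hom (tri_sub T S) Y Z" "h \<in> Hom (tri_sub T S) Z (ShO T 1 X)"
    using assms by (auto simp: dist_triangle_def)
  then show "dist_triangle T X Y Z" "Y \<in> S"
    by (auto simp: dist_triangle_def tri_sub_def[of T S] full_sub_def Hom_def)
qed

lemma ext_closure_tri_sub: "ext_closure (tri_sub T S) U \<subseteq> ext_closure T U"
proof
  fix X assume "X \<in> ext_closure (tri_sub T S) U"
  then show "X \<in> ext_closure T U"
    by induction (auto intro: ext_closure.incl ext_closure.ext dest: dist_triangle_tri_sub(1))
qed

lemma ext_closure_tri_sub_subset:
  assumes "U \<subseteq> S"
  shows "ext_closure (tri_sub T S) U \<subseteq> S"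
proof
  fix X assume "X \<in> ext_closure (tri_sub T S) U"
  then show "X \<in> S"
    by induction (use assms in \<open>auto dest: dist_triangle_tri_sub(2)\<close>)
qed

section \<open>Slicings of triangulated subcategories\<close>

text \<open>The slicing lives on \<open>tri_sub T S\<close>, but vanishing is stated for arrows of
  \<open>T\<close>, the common ground on which two components can be compared.\<close>

locale sliced_subcategory = triangulated_category T
  for T :: "('o, 'm, 'x) tricat_scheme" +
  fixes S :: "'o set" and P :: "real \<Rightarrow> 'o set"
  assumes triangulated_sub: "full_triangulated_subcategory T S"
    and slicing_sub: "slicing (tri_sub T S) P"
begin

lemma S_Ob: "S \<subseteq> Ob T"
  using triangulated_sub by (simp add: full_triangulated_subcategory_def)

lemma preadditive_tri_sub: "preadditive_category (tri_sub T S)"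
  using triangulated_sub
  by (simp add: full_triangulated_subcategory_def triangulated_category_def additive_category_def)

lemma ShO_in_S: "X \<in> S \<Longrightarrow> ShO T n X \<in> S"
  using triangulated_category.ShO_in_Ob[of "tri_sub T S" X n] triangulated_sub
  by (simp add: full_triangulated_subcategory_def)

lemma additive_P: "full_additive_subcategory (tri_sub T S) (P \<phi>)"
  using slicing_sub unfolding slicing_def by blast

lemma P_S: "P \<phi> \<subseteq> S"
  using additive_P[of \<phi>] by (simp add: full_additive_subcategory_def)

lemma P_Ob: "P \<phi> \<subseteq> Ob T"
  using P_S S_Ob by blast

lemma P_ShO:
  assumes "X \<in> P \<phi>"
  shows "ShO T 1 X \<in> P (\<phi> + 1)"
proof -
  have "P (\<phi> + 1) = ShO T 1 ` P \<phi>"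
    using slicing_sub unfolding slicing_def by (simp only: tri_sub_simps)
  then show ?thesis using assms by simp
qed

lemma P_ShO_obtain:
  assumes "X \<in> P \<phi>"
  obtains Y where "Y \<in> P (\<phi> - 1)" "X = ShO T 1 Y"
proof -
  have "P ((\<phi> - 1) + 1) = ShO T 1 ` P (\<phi> - 1)"
    using slicing_sub unfolding slicing_def by (simp only: tri_sub_simps)
  then show ?thesis using assms that by auto
qed

lemma Hom_zero_P:
  assumes "\<phi> > \<psi>" "X \<in> P \<phi>" "Y \<in> P \<psi>"
  shows "Hom_zero T X Y"
proof -
  have "Hom (tri_sub T S) X Y = {ZeroM T X Y}"
    using slicing_sub assms unfolding slicing_def Hom_vanish_def by (simp only: tri_sub_simps)
  then show ?thesis using assms P_S by (auto simp: Hom_tri_sub Hom_zero_def split: if_splits)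
qed

text \<open>Each slice is additive, hence has a zero object, and the identity criterion transports
  it to \<open>T\<close>.\<close>

lemma zero_obj_in_P: obtains N where "zero_obj T N" "N \<in> P \<phi>"
proof -
  interpret sub: additive_category "full_sub (tri_sub T S) (P \<phi>)"
    using additive_P by (simp add: full_additive_subcategory_def)
  obtain N where "zero_obj (full_sub (tri_sub T S) (P \<phi>)) N" using sub.zero_obj_exists by blast
  then have N: "N \<in> P \<phi>" "Ident T N = ZeroM T N N" by (simp_all add: sub.zero_obj_iff)
  then have "zero_obj T N" using P_Ob by (auto simp: zero_obj_iff)
  then show ?thesis using that N(1) by blast
qed

lemma zero_obj_tri_sub: "zero_obj (tri_sub T S) X \<longleftrightarrow> X \<in> S \<and> Ident T X = ZeroM T X X"
  using preadditive_category.zero_obj_iff[OF preadditive_tri_sub] by simp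

lemma zero_obj_if_Hom_zero: "X \<in> S \<Longrightarrow> Hom_zero T X X \<Longrightarrow> zero_obj (tri_sub T S) X"
  using Hom_zeroD[OF _ Ident_in_Hom[OF subsetD[OF S_Ob]]] by (simp add: zero_obj_tri_sub)

text \<open>An object with two different phases has Hom(X, X) = 0 and is therefore zero. For zero
  objects the value of \<open>phase\<close> is not controlled.\<close>

lemma phase_eq:
  assumes "X \<in> P \<phi>" "\<not> zero_obj (tri_sub T S) X"
  shows "phase P X = \<phi>"
  unfolding phase_def
proof (rule the_equality)
  fix \<psi> assume X: "X \<in> P \<psi>"
  show "\<psi> = \<phi>"
  proof (rule ccontr)
    assume "\<psi> \<noteq> \<phi>"
    then have "\<psi> < \<phi> \<or> \<phi> < \<psi>" by auto
    then have "Hom_zero T X X" using Hom_zero_P X assms(1) by blast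
    then show False using zero_obj_if_Hom_zero X P_S assms(2) by blast
  qed
qed (rule assms)

lemma slice_S: "slice (tri_sub T S) P I \<subseteq> S"
  unfolding slice_def by (rule ext_closure_tri_sub_subset) (use P_S in blast)

lemma slice_ext_closure: "slice (tri_sub T S) P I \<subseteq> ext_closure T (\<Union>\<phi>\<in>I. P \<phi>)"
  unfolding slice_def by (rule ext_closure_tri_sub)

lemma P_slice: "\<phi> \<in> I \<Longrightarrow> P \<phi> \<subseteq> slice (tri_sub T S) P I"
  unfolding slice_def by (auto intro: ext_closure.incl)

lemma UN_P_Ob: "(\<Union>\<phi>\<in>I. P \<phi>) \<subseteq> Ob T"
  using P_Ob by blast

text \<open>X is compared with itself, once as an object of phase \<phi> and once as an iterated
  extension of objects with phases in the interval. If \<phi> lay outside, one of these would have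
  larger phases than the other and the identity would vanish.\<close>

lemma slice_phase_mem:
  assumes X: "X \<in> slice (tri_sub T S) P {a <.. b}" "X \<in> P \<phi>" "\<not> zero_obj (tri_sub T S) X"
  shows "\<phi> \<in> {a <.. b}"
proof (rule ccontr)
  assume \<phi>: "\<phi> \<notin> {a <.. b}"
  let ?U = "\<Union>\<phi>\<in>{a <.. b}. P \<phi>"
  have XU: "X \<in> ext_closure T ?U" and X1: "X \<in> ext_closure T {X}"
    using X(1) slice_ext_closure by (auto intro: ext_closure.incl)
  have XS: "X \<in> S" and XO: "X \<in> Ob T" "{X} \<subseteq> Ob T" using X(2) P_S S_Ob by auto
  consider "\<phi> > b" | "\<phi> \<le> a" using \<phi> by force
  then have "Hom_zero T X (ShO T 0 X)"
  proof cases
    case 1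
    have "Hom_zero T X' (ShO T 0 Y)" if X': "X' \<in> {X}" and Y: "Y \<in> ?U" for X' Y
    proof -
      obtain \<psi> where \<psi>: "\<psi> \<in> {a <.. b}" "Y \<in> P \<psi>" using Y by blast
      moreover have "\<psi> < \<phi>" using \<psi>(1) 1 by simp
      ultimately show ?thesis using Hom_zero_P[OF _ X(2)] X' ShO_0[OF subsetD[OF P_Ob]] by auto
    qed
    from ext_closure_Hom_zero[OF this XO(2) UN_P_Ob X1 XU] show ?thesis .
  next
    case 2
    have "Hom_zero T Y (ShO T 0 X')" if Y: "Y \<in> ?U" and X': "X' \<in> {X}" for X' Y
    proof -
      obtain \<psi> where \<psi>: "\<psi> \<in> {a <.. b}" "Y \<in> P \<psi>" using Y by blast
      moreover have "\<psi> > \<phi>" using \<psi>(1) 2 by simp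
      ultimately show ?thesis using Hom_zero_P[OF _ _ X(2)] X' ShO_0[OF XO(1)] by auto
    qed
    from ext_closure_Hom_zero[OF this UN_P_Ob XO(2) XU X1] show ?thesis .
  qed
  then show False using zero_obj_if_Hom_zero[OF XS] X(3) ShO_0[OF XO(1)] by simp
qed

text \<open>On generators, X[1] has phase above 1 while Y has phase at most 1.\<close>

lemma Hom_zero_slice:
  assumes "X \<in> slice (tri_sub T S) P {0 <.. 1}" "Y \<in> slice (tri_sub T S) P {0 <.. 1}"
  shows "Hom_zero T X (ShO T (- 1) Y)"
proof (rule ext_closure_Hom_zero)
  fix X Y assume "X \<in> (\<Union>\<phi>\<in>{0 <.. 1}. P \<phi>)" "Y \<in> (\<Union>\<phi>\<in>{0 <.. 1}. P \<phi>)"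
  then obtain \<phi> \<psi> where *: "0 < \<phi>" "\<psi> \<le> 1" "X \<in> P \<phi>" "Y \<in> P \<psi>" by force
  then have "Hom_zero T (ShO T 1 X) Y" using Hom_zero_P[of \<psi> "\<phi> + 1"] P_ShO by auto
  then show "Hom_zero T X (ShO T (- 1) Y)"
    using Hom_zero_ShO_left[of X Y 1] * P_Ob by auto
qed (use assms slice_ext_closure UN_P_Ob in blast)+

end

section \<open>The second compatibility condition on semistable objects\<close>

lemma (in triangulated_category) Hom_le0_vanish_iff:
  assumes "\<X> \<subseteq> Ob T" "\<Y> \<subseteq> Ob T"
  shows "Hom_le0_vanish T \<X> \<Y> \<longleftrightarrow> (\<forall>X \<in> \<X>. \<forall>Y \<in> \<Y>. \<forall>i \<le> 0. Hom_zero T X (ShO T i Y))"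
proof -
  have "Hom T X (ShO T i Y) = {ZeroM T X (ShO T i Y)} \<longleftrightarrow> Hom_zero T X (ShO T i Y)"
    if "X \<in> \<X>" "Y \<in> \<Y>" for X Y i
    using Zero_in_Hom[of X "ShO T i Y"] ShO_in_Ob[of Y i] that assms by (auto simp: Hom_zero_def)
  then show ?thesis by (simp add: Hom_le0_vanish_def)
qed

text \<open>After shifting, the only case of the second compatibility condition that does not follow from
  the first is \<open>Hom(P\<^sub>A \<phi>, P\<^sub>B \<psi>[1]) = 0\<close> with \<open>\<psi> \<le> \<alpha> < \<phi>\<close>.\<close>

lemma Hom_le0_vanish_slices_iff:
  assumes "sliced_subcategory T S\<^sub>A P\<^sub>A" "sliced_subcategory T S\<^sub>B P\<^sub>B" and \<alpha>: "\<alpha> \<in> {0 <..< 1}"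
    and CP1: "Hom_le0_vanish T (slice (tri_sub T S\<^sub>A) P\<^sub>A {0 <.. 1}) (slice (tri_sub T S\<^sub>B) P\<^sub>B {0 <.. 1})"
  shows "Hom_le0_vanish T (slice (tri_sub T S\<^sub>A) P\<^sub>A {\<alpha> <.. \<alpha> + 1})
      (slice (tri_sub T S\<^sub>B) P\<^sub>B {\<alpha> <.. \<alpha> + 1}) \<longleftrightarrow>
    (\<forall>\<phi> \<in> {\<alpha> <.. 1}. \<forall>\<psi> \<in> {0 <.. \<alpha>}. \<forall>A \<in> P\<^sub>A \<phi>. \<forall>B \<in> P\<^sub>B \<psi>. Hom_zero T A (ShO T 1 B))"
    (is "?L \<longleftrightarrow> ?R")
proof -
  interpret A: sliced_subcategory T S\<^sub>A P\<^sub>A by fact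
  interpret B: sliced_subcategory T S\<^sub>B P\<^sub>B by fact
  \<comment> \<open>Slices are generated by extensions, so vanishing need only be tested on the
    objects of the \<open>P \<phi>\<close>.\<close>
  have iff: "Hom_le0_vanish T (slice (tri_sub T S\<^sub>A) P\<^sub>A I) (slice (tri_sub T S\<^sub>B) P\<^sub>B I) \<longleftrightarrow>
    (\<forall>\<phi> \<in> I. \<forall>\<psi> \<in> I. \<forall>A \<in> P\<^sub>A \<phi>. \<forall>B \<in> P\<^sub>B \<psi>. \<forall>i \<le> 0. Hom_zero T A (ShO T i B))"
    (is "?V \<longleftrightarrow> ?W") for I
  proof
    assume ?V
    then show ?W
      unfolding A.Hom_le0_vanish_iff[OF subset_trans[OF A.slice_S A.S_Ob] subset_trans[OF B.slice_S B.S_Ob]]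
      using A.P_slice B.P_slice by blast
  next
    assume W: ?W
    have "Hom_zero T X (ShO T i Y)"
      if "X \<in> slice (tri_sub T S\<^sub>A) P\<^sub>A I" "Y \<in> slice (tri_sub T S\<^sub>B) P\<^sub>B I" "i \<le> 0" for X Y i
    proof (rule A.ext_closure_Hom_zero[OF _ A.UN_P_Ob B.UN_P_Ob])
      show "X \<in> ext_closure T (\<Union> (P\<^sub>A ` I))" "Y \<in> ext_closure T (\<Union> (P\<^sub>B ` I))"
        using that A.slice_ext_closure B.slice_ext_closure by auto
    qed (use W that(3) in blast)
    then show ?V
      unfolding A.Hom_le0_vanish_iff[OF subset_trans[OF A.slice_S A.S_Ob] subset_trans[OF B.slice_S B.S_Ob]]
      by blast
  qed
  have cp1: "Hom_zero T X (ShO T i Y)"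
    if "X \<in> P\<^sub>A \<phi>" "Y \<in> P\<^sub>B \<psi>" "\<phi> \<in> {0 <.. 1}" "\<psi> \<in> {0 <.. 1}" "i \<le> 0" for X Y \<phi> \<psi> i
    using CP1 that unfolding iff by blast
  show ?thesis
    unfolding iff
  proof (intro iffI ballI allI impI)
    fix \<phi> \<psi> A B
    assume *: "\<forall>\<phi>\<in>{\<alpha><..\<alpha> + 1}. \<forall>\<psi>\<in>{\<alpha><..\<alpha> + 1}. \<forall>A\<in>P\<^sub>A \<phi>. \<forall>B\<in>P\<^sub>B \<psi>. \<forall>i\<le>0. Hom_zero T A (ShO T i B)"
      and **: "\<phi> \<in> {\<alpha><..1}" "\<psi> \<in> {0<..\<alpha>}" "A \<in> P\<^sub>A \<phi>" "B \<in> P\<^sub>B \<psi>"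
    \<comment> \<open>B[1] has phase in (\<alpha>, \<alpha> + 1], so the hypothesis in degree 0 is
      the required vanishing in degree 1.\<close>
    have "ShO T 1 B \<in> P\<^sub>B (\<psi> + 1)" using B.P_ShO **(4) .
    moreover have "\<phi> \<in> {\<alpha><..\<alpha> + 1}" "\<psi> + 1 \<in> {\<alpha><..\<alpha> + 1}" using ** \<alpha> by auto
    ultimately have "Hom_zero T A (ShO T 0 (ShO T 1 B))" using * **(3) by blast
    then show "Hom_zero T A (ShO T 1 B)"
      using A.ShO_0[OF A.ShO_in_Ob[OF subsetD[OF B.P_Ob **(4)]]] by simp
  next
    fix \<phi> \<psi> A B and i :: int
    assume R: ?R and \<phi>: "\<phi> \<in> {\<alpha><..\<alpha> + 1}" and \<psi>: "\<psi> \<in> {\<alpha><..\<alpha> + 1}"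
      and A: "A \<in> P\<^sub>A \<phi>" and B: "B \<in> P\<^sub>B \<psi>" and i: "i \<le> 0"
    have AO: "A \<in> Ob T" and BO: "B \<in> Ob T" using A B A.P_Ob B.P_Ob by auto
    show "Hom_zero T A (ShO T i B)"
    proof (cases "\<phi> \<le> 1")
      case \<phi>1: True
      show ?thesis
      proof (cases "\<psi> \<le> 1")
        case True
        then show ?thesis using cp1[OF A B _ _ i] \<phi> \<psi> \<phi>1 \<alpha> by auto
      next
        case False
        obtain B' where B': "B' \<in> P\<^sub>B (\<psi> - 1)" "B = ShO T 1 B'" using B.P_ShO_obtain[OF B] .
        \<comment> \<open>Bringing B into the heart raises the degree from i to i + 1; only i = 0
          leaves the range of (CP1).\<close>
        have eq: "ShO T i B = ShO T (i + 1) B'"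
          using A.ShO_add[OF subsetD[OF B.P_Ob B'(1)], of i 1] B'(2) by simp
        show ?thesis
        proof (cases "i = 0")
          case True
          have "\<phi> \<in> {\<alpha><..1}" "\<psi> - 1 \<in> {0<..\<alpha>}" using \<phi> \<psi> \<phi>1 False by auto
          then have "Hom_zero T A (ShO T 1 B')" using R A B'(1) by blast
          then show ?thesis using eq True by simp
        next
          case i0: False
          then show ?thesis
            using cp1[OF A B'(1), of "i + 1"] \<phi> \<psi> \<phi>1 False \<alpha> i eq by auto
        qed
      qed
    next
      case False
      \<comment> \<open>Bringing A into the heart lowers the degree to i - 1, so even a compensating
        shift of B stays in degrees at most 0.\<close>
      obtain A' where A': "A' \<in> P\<^sub>A (\<phi> - 1)" "A = ShO T 1 A'" using A.P_ShO_obtain[OF A] .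
      have A'O: "A' \<in> Ob T" using A' A.P_Ob by auto
      have "Hom_zero T A' (ShO T (i - 1) B)"
      proof (cases "\<psi> \<le> 1")
        case True
        then show ?thesis using cp1[OF A'(1) B, of "i - 1"] i \<phi> \<psi> False \<alpha> by auto
      next
        case \<psi>1: False
        obtain B' where B': "B' \<in> P\<^sub>B (\<psi> - 1)" "B = ShO T 1 B'" using B.P_ShO_obtain[OF B] .
        have "ShO T (i - 1) B = ShO T i B'"
          using A.ShO_add[OF subsetD[OF B.P_Ob B'(1)], of "i - 1" 1] B'(2) by simp
        then show ?thesis using cp1[OF A'(1) B'(1) _ _ i] \<phi> \<psi> False \<psi>1 \<alpha> by auto
      qed
      moreover have "ShO T (- 1) (ShO T i B) = ShO T (i - 1) B"
        using A.ShO_add[OF BO, of "- 1" i] by simp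
      ultimately show ?thesis
        using A.Hom_zero_ShO_left[OF A'O A.ShO_in_Ob[OF BO], of 1 i] A'(2) by simp
    qed
  qed
qed

theorem proposition1p7:
  fixes T :: "('o, 'm) tricat"
    and \<A> \<B> :: "'o set"
    and P\<^sub>A P\<^sub>B :: "real \<Rightarrow> 'o set"
    and Z\<^sub>A Z\<^sub>B :: "('o \<Rightarrow>\<^sub>0 int) set \<Rightarrow> complex"
    and \<A>\<^sub>0 \<B>\<^sub>0 :: "'o set"
  assumes "triangulated_category T"
    and "semiorthogonal_decomposition T \<A> \<B>"
    and "stability_condition (tri_sub T \<A>) P\<^sub>A Z\<^sub>A"
    and "stability_condition (tri_sub T \<B>) P\<^sub>B Z\<^sub>B"
    and "\<A>\<^sub>0 = heart (tri_sub T \<A>) P\<^sub>A"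
    and "\<B>\<^sub>0 = heart (tri_sub T \<B>) P\<^sub>B"
    and CP1: "Hom_le0_vanish T (slice (tri_sub T \<A>) P\<^sub>A {0 <.. 1}) (slice (tri_sub T \<B>) P\<^sub>B {0 <.. 1})"
  shows "(\<exists>\<alpha> \<in> {0 <..< 1}.
            Hom_le0_vanish T (slice (tri_sub T \<A>) P\<^sub>A {\<alpha> <.. \<alpha> + 1})
                             (slice (tri_sub T \<B>) P\<^sub>B {\<alpha> <.. \<alpha> + 1}))
         \<longleftrightarrow>
         (\<exists>\<alpha> \<in> {0 <..< 1}. \<forall>A \<in> \<A>\<^sub>0. \<forall>B \<in> \<B>\<^sub>0.
            semistable (tri_sub T \<A>) P\<^sub>A A \<longrightarrow> semistable (tri_sub T \<B>) P\<^sub>B B \<longrightarrow>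
            phase P\<^sub>B B \<le> \<alpha> \<and> \<alpha> < phase P\<^sub>A A \<longrightarrow>
            M0_vanishes T \<A>\<^sub>0 \<B>\<^sub>0 A B)"
proof -
  have subs: "full_triangulated_subcategory T \<A>" "full_triangulated_subcategory T \<B>"
    "Hom_vanish T \<B> \<A>"
    using assms(2) by (simp_all add: semiorthogonal_decomposition_def)
  have slicings: "slicing (tri_sub T \<A>) P\<^sub>A" "slicing (tri_sub T \<B>) P\<^sub>B"
    using assms(3,4) by (simp_all add: stability_condition_def bridgeland_stability_def)
  have AB: "sliced_subcategory T \<A> P\<^sub>A" "sliced_subcategory T \<B> P\<^sub>B"
    by (intro sliced_subcategory.intro sliced_subcategory_axioms.intro assms(1) subs slicings)+
  interpret A: sliced_subcategory T \<A> P\<^sub>A by fact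
  interpret B: sliced_subcategory T \<B> P\<^sub>B by fact
  have A0: "\<A>\<^sub>0 = slice (tri_sub T \<A>) P\<^sub>A {0 <.. 1}" and B0: "\<B>\<^sub>0 = slice (tri_sub T \<B>) P\<^sub>B {0 <.. 1}"
    using assms(5,6) by (simp_all add: heart_def)
  have A0S: "\<A>\<^sub>0 \<subseteq> \<A>" and B0S: "\<B>\<^sub>0 \<subseteq> \<B>" using A.slice_S B.slice_S A0 B0 by auto
  have Ob: "\<A>\<^sub>0 \<subseteq> Ob T" "\<B>\<^sub>0 \<subseteq> Ob T" using A0S B0S A.S_Ob B.S_Ob by auto
  \<comment> \<open>Phase 1 is an arbitrary choice in (0, 1]; it places a zero object in the
    heart.\<close>
  obtain N where N: "zero_obj T N" "N \<in> P\<^sub>A 1" using A.zero_obj_in_P .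
  have NA0: "N \<in> \<A>\<^sub>0" using A.P_slice[of 1 "{0 <.. 1}"] N(2) A0 by auto
  have orth: "Hom_zero T (ShO T n Y) X" if "Y \<in> \<B>\<^sub>0" "X \<in> \<A>\<^sub>0" for X Y n
  proof -
    have "ShO T n Y \<in> \<B>" "X \<in> \<A>" using that B.ShO_in_S A0S B0S by auto
    then show ?thesis using subs(3) by (simp add: Hom_vanish_def Hom_zero_def)
  qed
  have neg: "Hom_zero T X (ShO T (- 1) Y)" if XY: "X \<in> \<A>\<^sub>0 \<union> \<B>\<^sub>0" "Y \<in> \<A>\<^sub>0 \<union> \<B>\<^sub>0" for X Y
  proof -
    \<comment> \<open>Pairs from one heart are handled by its slicing, A against B by (CP1) with i =
      -1, and B against A by semiorthogonality.\<close>
    consider "X \<in> \<A>\<^sub>0" "Y \<in> \<A>\<^sub>0" | "X \<in> \<A>\<^sub>0" "Y \<in> \<B>\<^sub>0" | "X \<in> \<B>\<^sub>0" "Y \<in> \<A>\<^sub>0" | "X \<in> \<B>\<^sub>0" "Y \<in> \<B>\<^sub>0"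
      using XY by blast
    then show ?thesis
    proof cases
      case 1
      then show ?thesis using A.Hom_zero_slice A0 by simp
    next
      case 2
      then show ?thesis
        using CP1 A.Hom_le0_vanish_iff[OF Ob] unfolding A0[symmetric] B0[symmetric] by simp
    next
      case 3
      then have "X \<in> Ob T" "Y \<in> Ob T" using Ob by auto
      then show ?thesis using orth[OF 3, of 1] A.Hom_zero_ShO_left[of X Y 1] by simp
    next
      case 4
      then show ?thesis using B.Hom_zero_slice B0 by simp
    qed
  qed
  have M0: "M0_vanishes T \<A>\<^sub>0 \<B>\<^sub>0 X Y \<longleftrightarrow> Hom_zero T X (ShO T 1 Y)" if "X \<in> \<A>\<^sub>0" "Y \<in> \<B>\<^sub>0" for X Y
    unfolding M0_vanishes_def M0_def
    by (rule A.Ext1_gl_zero_iff[OF Ob N(1) NA0 orth neg that])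
  have "(\<forall>\<phi> \<in> {\<alpha> <.. 1}. \<forall>\<psi> \<in> {0 <.. \<alpha>}. \<forall>X \<in> P\<^sub>A \<phi>. \<forall>Y \<in> P\<^sub>B \<psi>. Hom_zero T X (ShO T 1 Y)) \<longleftrightarrow>
    (\<forall>X \<in> \<A>\<^sub>0. \<forall>Y \<in> \<B>\<^sub>0. semistable (tri_sub T \<A>) P\<^sub>A X \<longrightarrow> semistable (tri_sub T \<B>) P\<^sub>B Y \<longrightarrow>
      phase P\<^sub>B Y \<le> \<alpha> \<and> \<alpha> < phase P\<^sub>A X \<longrightarrow> M0_vanishes T \<A>\<^sub>0 \<B>\<^sub>0 X Y)" (is "?L \<longleftrightarrow> ?R")
    if \<alpha>: "\<alpha> \<in> {0 <..< 1}" for \<alpha>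
  proof
    assume L: ?L
    show ?R
    proof (intro ballI impI)
      fix X Y assume X: "X \<in> \<A>\<^sub>0" and Y: "Y \<in> \<B>\<^sub>0"
        and ss: "semistable (tri_sub T \<A>) P\<^sub>A X" "semistable (tri_sub T \<B>) P\<^sub>B Y"
        and ph: "phase P\<^sub>B Y \<le> \<alpha> \<and> \<alpha> < phase P\<^sub>A X"
      obtain \<phi> where \<phi>: "X \<in> P\<^sub>A \<phi>" and nX: "\<not> zero_obj (tri_sub T \<A>) X"
        using ss(1) by (auto simp: semistable_def)
      obtain \<psi> where \<psi>: "Y \<in> P\<^sub>B \<psi>" and nY: "\<not> zero_obj (tri_sub T \<B>) Y"
        using ss(2) by (auto simp: semistable_def)
      have "\<phi> \<in> {0 <.. 1}" "\<psi> \<in> {0 <.. 1}"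
        using A.slice_phase_mem[OF _ \<phi> nX] B.slice_phase_mem[OF _ \<psi> nY] X Y A0 B0 by auto
      then have "\<phi> \<in> {\<alpha> <.. 1}" "\<psi> \<in> {0 <.. \<alpha>}"
        using ph A.phase_eq[OF \<phi> nX] B.phase_eq[OF \<psi> nY] by auto
      then show "M0_vanishes T \<A>\<^sub>0 \<B>\<^sub>0 X Y" using L \<phi> \<psi> M0[OF X Y] by blast
    qed
  next
    assume R: ?R
    show ?L
    proof (intro ballI)
      fix \<phi> \<psi> X Y assume \<phi>: "\<phi> \<in> {\<alpha> <.. 1}" and \<psi>: "\<psi> \<in> {0 <.. \<alpha>}" and X: "X \<in> P\<^sub>A \<phi>" and Y: "Y \<in> P\<^sub>B \<psi>"
      have XO: "X \<in> Ob T" and YO: "Y \<in> Ob T" "ShO T 1 Y \<in> Ob T"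
        using subsetD[OF A.P_Ob X] subsetD[OF B.P_Ob Y] A.ShO_in_Ob by auto
      show "Hom_zero T X (ShO T 1 Y)"
      \<comment> \<open>Slices contain zero objects, which are not \<open>semistable\<close>; for
        them Hom vanishes directly.\<close>
      proof (cases "Ident T X = ZeroM T X X \<or> Ident T Y = ZeroM T Y Y")
        case True
        then show ?thesis
        proof
          assume "Ident T X = ZeroM T X X"
          then show ?thesis using A.Hom_zero_Ident_left[OF _ XO] by simp
        next
          assume "Ident T Y = ZeroM T Y Y"
          then have "Ident T (ShO T 1 Y) = ZeroM T (ShO T 1 Y) (ShO T 1 Y)"
            using A.ShA_Ident[OF YO(1), of 1] A.ShA_Zero[OF YO(1) YO(1), of 1] by simp
          then show ?thesis using A.Hom_zero_Ident_right[OF _ YO(2)] by simp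
        qed
      next
        case False
        then have nX: "\<not> zero_obj (tri_sub T \<A>) X" and nY: "\<not> zero_obj (tri_sub T \<B>) Y"
          by (simp_all add: A.zero_obj_tri_sub B.zero_obj_tri_sub)
        have X0: "X \<in> \<A>\<^sub>0" and Y0: "Y \<in> \<B>\<^sub>0"
          using A.P_slice[of \<phi> "{0 <.. 1}"] B.P_slice[of \<psi> "{0 <.. 1}"] X Y \<phi> \<psi> \<alpha> A0 B0 by auto
        have "semistable (tri_sub T \<A>) P\<^sub>A X" "semistable (tri_sub T \<B>) P\<^sub>B Y"
          using X Y nX nY by (auto simp: semistable_def)
        moreover have "phase P\<^sub>B Y \<le> \<alpha> \<and> \<alpha> < phase P\<^sub>A X"
          using A.phase_eq[OF X nX] B.phase_eq[OF Y nY] \<phi> \<psi> by simp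
        ultimately have "M0_vanishes T \<A>\<^sub>0 \<B>\<^sub>0 X Y" using R X0 Y0 by blast
        then show ?thesis using M0[OF X0 Y0] by simp
      qed
    qed
  qed
  \<comment> \<open>The same \<alpha> serves on both sides, so the existential statements agree term
    by term.\<close>
  with Hom_le0_vanish_slices_iff[OF AB _ CP1] show ?thesis
    by (intro bex_cong refl) simp
qed

end
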